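(* Let $J,R,Q,E\in\mathbb{R}^{n\times n}$ and $B\in\mathbb{R}^{n\times m}$ satisfy $J=-J^\top$, $R=R^\top\ge 0$, $Q^\top E=E^\top Q\ge 0$, and $RQ\neq 0$, and assume that the matrix pencil $sE-(J-R)Q$ is regular and has index one. Let $\mathbb{U}\subset\mathbb{R}^m$ be convex and compact with $0\in\operatorname{int}\mathbb{U}$, and let $\Psi\subset\operatorname{im}E$ be closed. For $T>0$ and $w^0\in\operatorname{im}E$ consider the optimal control problem $$ \min_{u\in L^1(0,T;\mathbb{U})}\int_0^T u(t)^\top y(t)\,dt\quad\text{s.t. } \tfrac{d}{dt}Ex=(J-R)Qx+Bu,\quad y=B^\top Qx,\quad Ex(0)=w^0,\quad Ex(T)\in\Psi. \qquad (\mathrm{OCP}_{T,w^0}) $$ Let $(\bar w,\bar u)\in\operatorname{im}E\times\operatorname{int}\mathbb{U}$ be an optimal steady state of this problem such that $\bar w\in\mathcal{C}(\Psi)$. Then the problem has the integral state subspace turnpike property on $\mathcal{C}(\bar w)$ with respect to $\ker(RQ)$, i.e., there exist continuous functions $F,\tau:\mathcal{C}(\bar w)\to[0,\infty)$ such that for all $w^0\in\mathcal{C}(\bar w)$, all $T>\tau(w^0)$, and each optimal pair $(x^\star,u^\star)$ of $(\mathrm{OCP}_{T,w^0})$, $$ \int_0^T\operatorname{dist}^2\big(x^\star(t),\ker(RQ)\big)\,dt\le F(w^0). $$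
   Context: Regularity and index: a pencil $sE-A$ ($E,A\in\mathbb{R}^{n\times n}$) is regular if $\mu E-A$ is invertible for some $\mu\ne 0$. Its index is the smallest $k\ge 0$ with $\ker T^{k+1}=\ker T^{k}$, where $T=(\mu E-A)^{-1}E$. Solutions: $x$ is a solution of $\frac{d}{dt}Ex=(J-R)Qx+Bu$ if $x$ is (locally) $L^1$, $Ex$ is (locally) $W^{1,1}$ (so $Ex$ has a continuous representative, whose values are meant in $Ex(0)$, $Ex(T)$), and the equation holds almost everywhere. $L^1(0,T;\mathbb{U})$ denotes the integrable functions on $[0,T]$ with values in $\mathbb{U}$. Reachability: for $t>0$ and $w,w^0\in\operatorname{im}E$, $w$ is reachable from $w^0$ at time $t$ if there is $u\in L^1(0,t;\mathbb{U})$ such that the solution $x$ with $Ex(0)=w^0$ satisfies $Ex(t)=w$. $\mathcal{C}_t(w)$ is the set of vectors in $\operatorname{im}E$ from which $w$ is reachable at time $t$, $\mathcal{C}_0(w)=\{w\}$, $\mathcal{C}(w)=\bigcup_{t\ge0}\mathcal{C}_t(w)$, $\mathcal{C}(\Psi)=\bigcup_{w\in\Psi}\mathcal{C}(w)$. Steady states: $(\bar w,\bar u)\in\operatorname{im}E\times\mathbb{U}$ is a steady state if there is $\bar x\in\mathbb{R}^n$ with $E\bar x=\bar w$ and $(J-R)Q\bar x+B\bar u=0$ (such $\bar x$ is unique by regularity). It is optimal if it minimizes $u^\top y$ over all $(w,u)\in\operatorname{im}E\times\mathbb{U}$ subject to $0=(J-R)Qx+Bu$, $y=B^\top Qx$,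 $w=Ex$. An optimal pair is a pair $(x^\star,u^\star)$ consisting of an optimal control and the corresponding state. $\operatorname{dist}$ is the Euclidean distance. *)

theory Defs
  imports "HOL-Analysis.Analysis"
begin

definition im :: "real^'k^'n \<Rightarrow> (real^'n) set" where
  "im M = range (\<lambda>x. M *v x)"

definition ker :: "real^'k^'n \<Rightarrow> (real^'k) set" where
  "ker M = {x. M *v x = 0}"

definition symmetric_psd :: "real^'n^'n \<Rightarrow> bool" where
  "symmetric_psd M \<longleftrightarrow> transpose M = M \<and> (\<forall>x. 0 \<le> x \<bullet> (M *v x))"


subsection \<open>Matrix pencils\<close>

definition regular_pencil :: "real^'n^'n \<Rightarrow> real^'n^'n \<Rightarrow> bool" where
  "regular_pencil E A \<longleftrightarrow> (\<exists>\<mu>. \<mu> \<noteq> 0 \<and> invertible (\<mu> *\<^sub>R E - A))"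

text \<open>Powers of a matrix are taken as iterates of the linear map it induces, since the
  multiplication of the type class \<open>times\<close> on vectors is componentwise.\<close>

definition stabilization_index :: "real^'n^'n \<Rightarrow> nat" where
  "stabilization_index T =
     (LEAST k. {x. ((\<lambda>v. T *v v) ^^ (k + 1)) x = 0} = {x. ((\<lambda>v. T *v v) ^^ k) x = 0})"

text \<open>The index of a regular pencil does not depend on the choice of \<open>\<mu>\<close>.\<close>

definition pencil_has_index :: "real^'n^'n \<Rightarrow> real^'n^'n \<Rightarrow> nat \<Rightarrow> bool" where
  "pencil_has_index E A k \<longleftrightarrow>
     (\<exists>\<mu>. \<mu> \<noteq> 0 \<and> invertible (\<mu> *\<^sub>R E - A) \<and>
          stabilization_index (matrix_inv (\<mu> *\<^sub>R E - A) ** E) = k)"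


subsection \<open>Sobolev functions on an interval and solutions\<close>

definition test_function_on :: "real \<Rightarrow> (real \<Rightarrow> real) \<Rightarrow> (real \<Rightarrow> real) \<Rightarrow> bool" where
  "test_function_on T \<phi> \<phi>' \<longleftrightarrow>
     (\<forall>t. (\<phi> has_real_derivative \<phi>' t) (at t)) \<and> continuous_on UNIV \<phi>' \<and>
     (\<exists>a b. 0 < a \<and> b < T \<and> (\<forall>t. t \<notin> {a..b} \<longrightarrow> \<phi> t = 0))"

text \<open>\<open>f\<close> is in \<open>W\<^sup>1\<^sup>,\<^sup>1(0, T)\<close> with weak derivative \<open>g\<close>. As in Brezis' textbook, the test functions
  are continuously differentiable with compact support in the open interval; smooth test
  functions give the same notion.\<close>

definition W11_with_derivative ::
    "real \<Rightarrow> (real \<Rightarrow> real^'n) \<Rightarrow> (real \<Rightarrow> real^'n) \<Rightarrow> bool" where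
  "W11_with_derivative T f g \<longleftrightarrow>
     f absolutely_integrable_on {0..T} \<and> g absolutely_integrable_on {0..T} \<and>
     (\<forall>\<phi> \<phi>'. test_function_on T \<phi> \<phi>' \<longrightarrow>
        (LINT t:{0..T}|lebesgue. \<phi>' t *\<^sub>R f t) = - (LINT t:{0..T}|lebesgue. \<phi> t *\<^sub>R g t))"

text \<open>The value at \<open>s\<close> of the continuous representative of \<open>f\<close> is \<open>w\<close>. For \<open>T > 0\<close> there is
  at most one such \<open>w\<close>.\<close>

definition has_value_at :: "real \<Rightarrow> (real \<Rightarrow> real^'n) \<Rightarrow> real \<Rightarrow> real^'n \<Rightarrow> bool" where
  "has_value_at T f s w \<longleftrightarrow>
     (\<exists>z. continuous_on {0..T} z \<and> (AE t in lebesgue. t \<in> {0..T} \<longrightarrow> f t = z t) \<and> z s = w)"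

text \<open>\<open>x\<close> solves \<open>d/dt (E x) = A x + B u\<close> on \<open>[0, T]\<close>.\<close>

definition is_solution ::
    "real^'n^'n \<Rightarrow> real^'n^'n \<Rightarrow> real^'m^'n \<Rightarrow> real \<Rightarrow>
     (real \<Rightarrow> real^'m) \<Rightarrow> (real \<Rightarrow> real^'n) \<Rightarrow> bool" where
  "is_solution E A B T u x \<longleftrightarrow>
     x absolutely_integrable_on {0..T} \<and>
     (\<exists>g. W11_with_derivative T (\<lambda>t. E *v x t) g \<and>
          (AE t in lebesgue. t \<in> {0..T} \<longrightarrow> g t = A *v x t + B *v u t))"

definition admissible_control :: "(real^'m) set \<Rightarrow> real \<Rightarrow> (real \<Rightarrow> real^'m) \<Rightarrow> bool" where
  "admissible_control U T u \<longleftrightarrow>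
     u absolutely_integrable_on {0..T} \<and> (AE t in lebesgue. t \<in> {0..T} \<longrightarrow> u t \<in> U)"


subsection \<open>Reachability\<close>

text \<open>\<open>C\<^sub>t(w)\<close>: the points from which \<open>w\<close> can be reached at time \<open>t\<close>.\<close>

definition reach_set_at ::
    "real^'n^'n \<Rightarrow> real^'n^'n \<Rightarrow> real^'m^'n \<Rightarrow> (real^'m) set \<Rightarrow> real \<Rightarrow> real^'n \<Rightarrow> (real^'n) set" where
  "reach_set_at E A B U t w =
     (if t = 0 then {w}
      else {w0 \<in> im E. \<exists>u x. admissible_control U t u \<and> is_solution E A B t u x \<and>
              has_value_at t (\<lambda>s. E *v x s) 0 w0 \<and> has_value_at t (\<lambda>s. E *v x s) t w})"

definition reach_set ::
    "real^'n^'n \<Rightarrow> real^'n^'n \<Rightarrow> real^'m^'n \<Rightarrow> (real^'m) set \<Rightarrow> real^'n \<Rightarrow> (real^'n) set" where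
  "reach_set E A B U w = (\<Union>t\<in>{0..}. reach_set_at E A B U t w)"

definition reach_set_of ::
    "real^'n^'n \<Rightarrow> real^'n^'n \<Rightarrow> real^'m^'n \<Rightarrow> (real^'m) set \<Rightarrow> (real^'n) set \<Rightarrow> (real^'n) set" where
  "reach_set_of E A B U \<Psi> = (\<Union>w\<in>\<Psi>. reach_set E A B U w)"


subsection \<open>The optimal control problem for \<open>d/dt (E x) = (J - R) Q x + B u\<close>, \<open>y = B\<^sup>T Q x\<close>\<close>

definition sys_output :: "real^'n^'n \<Rightarrow> real^'m^'n \<Rightarrow> real^'n \<Rightarrow> real^'m" where
  "sys_output Q B x = (transpose B ** Q) *v x"

definition ocp_feasible ::
    "real^'n^'n \<Rightarrow> real^'n^'n \<Rightarrow> real^'n^'n \<Rightarrow> real^'n^'n \<Rightarrow> real^'m^'n \<Rightarrow> (real^'m) set \<Rightarrow>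
     (real^'n) set \<Rightarrow> real \<Rightarrow> real^'n \<Rightarrow> (real \<Rightarrow> real^'n) \<Rightarrow> (real \<Rightarrow> real^'m) \<Rightarrow> bool" where
  "ocp_feasible E J R Q B U \<Psi> T w0 x u \<longleftrightarrow>
     admissible_control U T u \<and> is_solution E ((J - R) ** Q) B T u x \<and>
     has_value_at T (\<lambda>t. E *v x t) 0 w0 \<and>
     (\<exists>w\<in>\<Psi>. has_value_at T (\<lambda>t. E *v x t) T w)"

definition ocp_cost ::
    "real^'n^'n \<Rightarrow> real^'m^'n \<Rightarrow> real \<Rightarrow> (real \<Rightarrow> real^'n) \<Rightarrow> (real \<Rightarrow> real^'m) \<Rightarrow> real" where
  "ocp_cost Q B T x u = (LINT t:{0..T}|lebesgue. u t \<bullet> sys_output Q B (x t))"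

definition ocp_optimal_pair ::
    "real^'n^'n \<Rightarrow> real^'n^'n \<Rightarrow> real^'n^'n \<Rightarrow> real^'n^'n \<Rightarrow> real^'m^'n \<Rightarrow> (real^'m) set \<Rightarrow>
     (real^'n) set \<Rightarrow> real \<Rightarrow> real^'n \<Rightarrow> (real \<Rightarrow> real^'n) \<Rightarrow> (real \<Rightarrow> real^'m) \<Rightarrow> bool" where
  "ocp_optimal_pair E J R Q B U \<Psi> T w0 x u \<longleftrightarrow>
     ocp_feasible E J R Q B U \<Psi> T w0 x u \<and>
     (\<forall>x' u'. ocp_feasible E J R Q B U \<Psi> T w0 x' u' \<longrightarrow> ocp_cost Q B T x u \<le> ocp_cost Q B T x' u')"


subsection \<open>Steady states\<close>

text \<open>\<open>(w, u)\<close> is a steady state with associated state \<open>x\<close>, which is unique for a regular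
  pencil.\<close>

definition steady_state_with ::
    "real^'n^'n \<Rightarrow> real^'n^'n \<Rightarrow> real^'n^'n \<Rightarrow> real^'n^'n \<Rightarrow> real^'m^'n \<Rightarrow> (real^'m) set \<Rightarrow>
     real^'n \<Rightarrow> real^'m \<Rightarrow> real^'n \<Rightarrow> bool" where
  "steady_state_with E J R Q B U w u x \<longleftrightarrow>
     w \<in> im E \<and> u \<in> U \<and> E *v x = w \<and> ((J - R) ** Q) *v x + B *v u = 0"

definition optimal_steady_state ::
    "real^'n^'n \<Rightarrow> real^'n^'n \<Rightarrow> real^'n^'n \<Rightarrow> real^'n^'n \<Rightarrow> real^'m^'n \<Rightarrow> (real^'m) set \<Rightarrow>
     real^'n \<Rightarrow> real^'m \<Rightarrow> bool" where
  "optimal_steady_state E J R Q B U w u \<longleftrightarrow>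
     (\<exists>x. steady_state_with E J R Q B U w u x \<and>
        (\<forall>w' u' x'. steady_state_with E J R Q B U w' u' x' \<longrightarrow>
           u \<bullet> sys_output Q B x \<le> u' \<bullet> sys_output Q B x'))"

end

theory Submission
  imports Defs
begin

text \<open>Energy balance: along a trajectory from \<open>w\<^sub>0\<close> to \<open>w\<close> the cost equals \<open>H w - H w\<^sub>0\<close> plus the
  integral of the dissipation rate \<open>Qx \<bullet> R Q x\<close>, where \<open>H\<close> is the stored energy. At an optimal
  steady state the dissipation rate vanishes, since the origin is a competitor of cost zero. Comparing an
  optimal pair with the control that steers to \<open>wbar\<close>, waits there at no cost, and then moves on to \<open>\<Psi>\<close>
  bounds the dissipation by a quantity that does not depend on the horizon.

  For continuous bounds, time and dissipation needed to reach \<open>wbar\<close> must be locally bounded on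
  \<open>S = C(wbar)\<close>. The sets \<open>D r\<close> of points steered to \<open>wbar\<close> in time \<open>r\<close> with dissipation at most \<open>r\<close>
  are convex, increase to \<open>S\<close>, and are mapped into themselves by a contracted reflection through \<open>wbar\<close>,
  because \<open>ubar\<close> is interior. Hence some \<open>D r\<close> is a neighbourhood of \<open>wbar\<close> relative to the span \<open>V\<close> of
  \<open>S - wbar\<close>. As \<open>V\<close> is invariant under the uncontrolled flow, a small perturbation in \<open>V\<close> of the
  initial value of a trajectory ending in \<open>wbar\<close> ends in this neighbourhood.\<close>

section \<open>Indefinite integrals and weak derivatives\<close>

text \<open>The state \<open>x\<close> is merely integrable: it has no point values, and its
  quadratic dissipation rate need not be integrable a priori. All bookkeeping is therefore done on
  \<open>E x\<close>, through its continuous representative as an indefinite integral. A lift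
  \<open>X\<close> from \<open>im E\<close> back to states, provided by index one, expresses stored
  energy and free motion in terms of \<open>E x\<close> alone. Integrability of the dissipation rate
  is then a conclusion of the energy balance: boundedness of \<open>U\<close> makes the supplied
  power integrable, and the power stored is integrable as well.

  The other obstacle is that no controllability is assumed, so C(wbar) may lie in a proper affine
  subspace of \<open>im E\<close>. The reflection takes the place of controllability: a convex set
  that contains 0 and a shrunken mirror image of each of its points has 0 in its relative interior.
  No steering time is shown to be continuous; a monotone family of sets that is locally exhausting
  already admits a continuous choice of the parameter.\<close>

lemma AE_zero_if_indefinite_integral_zero:
  fixes k :: "real \<Rightarrow> 'a::euclidean_space"
  assumes k: "k absolutely_integrable_on {a..b}"
    and 0: "\<And>t. t \<in> {a..b} \<Longrightarrow> integral {a..t} k = 0"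
  shows "AE t in lebesgue. t \<in> {a..b} \<longrightarrow> k t = 0"
proof -
  have ki: "k integrable_on cbox a b"
    using set_lebesgue_integral_eq_integral(1)[OF k] by simp
  have sub0: "integral {c..d} k = 0" if "a \<le> c" "c \<le> d" "d \<le> b" for c d
  proof -
    have "k integrable_on {a..d}"
      by (rule integrable_on_subinterval[OF ki]) (use that in auto)
    then have "integral {a..c} k + integral {c..d} k = integral {a..d} k"
      using that by (intro Henstock_Kurzweil_Integration.integral_combine) auto
    then show ?thesis
      using 0[of c] 0[of d] that by simp
  qed
  \<comment> \<open>Henstock's lemma bounds the summed deviations of a fine Riemann sum from the
    integrals over its cells. Here all cell integrals vanish, so these deviations are the Riemann
    sum of \<open>norm k\<close> itself.\<close>
  have "((\<lambda>t. norm (k t)) has_integral 0) (cbox a b)"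
    unfolding has_integral
  proof (intro allI impI)
    fix e :: real
    assume e: "e > 0"
    obtain \<gamma> where \<gamma>: "gauge \<gamma>" and *:
      "\<And>p. \<lbrakk>p tagged_partial_division_of (cbox a b); \<gamma> fine p\<rbrakk> \<Longrightarrow>
             sum (\<lambda>(x,K). norm(measure lborel K *\<^sub>R k x - integral K k)) p < e"
      using Henstock_lemma[OF ki e] by blast
    show "\<exists>\<gamma>. gauge \<gamma> \<and> (\<forall>\<D>. \<D> tagged_division_of cbox a b \<and> \<gamma> fine \<D> \<longrightarrow>
           norm ((\<Sum>(x,K)\<in>\<D>. measure lborel K *\<^sub>R norm (k x)) - 0) < e)"
    proof (intro exI conjI allI impI)
      fix \<D> assume D: "\<D> tagged_division_of cbox a b \<and> \<gamma> fine \<D>"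
      have "(\<Sum>(x,K)\<in>\<D>. measure lborel K *\<^sub>R norm (k x)) =
            (\<Sum>(x,K)\<in>\<D>. norm (measure lborel K *\<^sub>R k x - integral K k))"
      proof (rule sum.cong)
        fix y assume y: "y \<in> \<D>"
        obtain x K where xK: "y = (x, K)" by (cases y)
        obtain c d where cd: "K = cbox c d"
          using tagged_division_ofD(4)[of \<D> "cbox a b" x K] D y xK by auto
        have "x \<in> K" "K \<subseteq> cbox a b"
          using tagged_division_ofD(2,3)[of \<D> "cbox a b" x K] D y xK by auto
        then have "integral K k = 0"
          using sub0[of c d] cd by auto
        then show "(case y of (x, K) \<Rightarrow> measure lborel K *\<^sub>R norm (k x)) =
           (case y of (x, K) \<Rightarrow> norm (measure lborel K *\<^sub>R k x - integral K k))"
          by (simp add: xK)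
      qed simp
      moreover have "\<dots> < e"
        using D by (intro *) (auto simp: tagged_division_of_def)
      moreover have "0 \<le> (\<Sum>(x,K)\<in>\<D>. measure lborel K *\<^sub>R norm (k x))"
        by (intro sum_nonneg) auto
      ultimately show "norm ((\<Sum>(x,K)\<in>\<D>. measure lborel K *\<^sub>R norm (k x)) - 0) < e"
        by simp
    qed (fact \<gamma>)
  qed
  then have *: "integral {a..b} (\<lambda>t. norm (k t)) = 0"
    by (simp add: integral_unique)
  have n: "(\<lambda>t. norm (k t)) absolutely_integrable_on {a..b}"
    using absolutely_integrable_norm[OF k] by (simp add: o_def)
  have "(LINT t|lebesgue. norm (indicator {a..b} t *\<^sub>R k t)) = 0"
    using set_lebesgue_integral_eq_integral(2)[OF n] *
    by (simp add: set_lebesgue_integral_def)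
  then have "AE t in lebesgue. indicator {a..b} t *\<^sub>R k t = 0"
    using integral_nonneg_eq_0_iff_AE[of lebesgue "\<lambda>t. norm (indicator {a..b} t *\<^sub>R k t)"] k
    by (simp add: set_integrable_def del: norm_scaleR)
  then show ?thesis
    by eventually_elim (auto simp: indicator_def split: if_splits)
qed

text \<open>Completion does not change the measure of Borel sets, so the countable cover of
  \<open>lborel\<close> serves again. It opens Fubini for integrands that are only Lebesgue
  measurable.\<close>

lemma sigma_finite_lebesgue: "sigma_finite_measure (lebesgue :: 'a::euclidean_space measure)"
proof -
  obtain A :: "'a set set" where A: "countable A" "A \<subseteq> sets lborel" "\<Union>A = space lborel"
    "\<forall>a\<in>A. emeasure lborel a \<noteq> \<infinity>"
    using lborel.sigma_finite_countable by metis
  then show ?thesis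
    unfolding sigma_finite_measure_def by (intro exI[of _ A]) auto
qed

section \<open>Integration by parts for indefinite integrals\<close>

lemma absolutely_integrable_inner_continuous:
  fixes f g :: "real \<Rightarrow> 'a::euclidean_space"
  assumes "continuous_on {a..b} f" "g absolutely_integrable_on {a..b}"
  shows "(\<lambda>t. f t \<bullet> g t) absolutely_integrable_on {a..b}"
proof (rule absolutely_integrable_bounded_measurable_product[where h = "(\<bullet>)"])
  show "bilinear ((\<bullet>) :: 'a \<Rightarrow> 'a \<Rightarrow> real)"
    by (simp add: bilinear_conv_bounded_bilinear bounded_bilinear_inner)
  show "f \<in> borel_measurable (lebesgue_on {a..b})"
    by (rule continuous_imp_measurable_on_sets_lebesgue[OF assms(1)]) auto
  show "bounded (f ` {a..b})"
    by (rule compact_imp_bounded[OF compact_continuous_image[OF assms(1)]]) auto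
qed (use assms in auto)

lemma continuous_on_indefinite_integral:
  fixes f :: "real \<Rightarrow> 'a::euclidean_space"
  assumes "f absolutely_integrable_on {a..b}"
  shows "continuous_on {a..b} (\<lambda>t. integral {a..t} f)"
  using set_lebesgue_integral_eq_integral(1)[OF assms] indefinite_integral_continuous_1 by auto

lemma integrable_pair_inner:
  fixes p q :: "real \<Rightarrow> 'a::euclidean_space"
  assumes "integrable lebesgue p" "integrable lebesgue q"
  shows "integrable (lebesgue \<Otimes>\<^sub>M lebesgue) (\<lambda>(s, t). p s \<bullet> q t)"
proof -
  interpret L: sigma_finite_measure "lebesgue :: real measure" by (rule sigma_finite_lebesgue)
  interpret P: pair_sigma_finite "lebesgue :: real measure" "lebesgue :: real measure" ..
  have [measurable]: "p \<in> borel_measurable lebesgue" "q \<in> borel_measurable lebesgue"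
    using assms by auto
  show ?thesis
  proof (rule P.Fubini_integrable)
    show "AE x in lebesgue. integrable lebesgue (\<lambda>y. case (x, y) of (s, t) \<Rightarrow> p s \<bullet> q t)"
      using assms by auto
    show "(\<lambda>(s, t). p s \<bullet> q t) \<in> borel_measurable (lebesgue \<Otimes>\<^sub>M lebesgue)"
      by measurable
    let ?c = "LINT y|lebesgue. norm (q y)"
    show "integrable lebesgue (\<lambda>x. LINT y|lebesgue. norm (case (x, y) of (s, t) \<Rightarrow> p s \<bullet> q t))"
    proof (rule Bochner_Integration.integrable_bound)
      show "integrable lebesgue (\<lambda>x. norm (p x) * ?c)"
        using assms by auto
      show "(\<lambda>x. LINT y|lebesgue. norm (case (x, y) of (s, t) \<Rightarrow> p s \<bullet> q t)) \<in> borel_measurable lebesgue"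
        by measurable
      show "AE x in lebesgue. norm (LINT y|lebesgue. norm (case (x, y) of (s, t) \<Rightarrow> p s \<bullet> q t))
        \<le> norm (norm (p x) * ?c)"
      proof (rule AE_I2)
        fix x
        have "(LINT y|lebesgue. norm (p x \<bullet> q y)) \<le> (LINT y|lebesgue. norm (p x) * norm (q y))"
          using assms by (intro integral_mono) (auto simp: Cauchy_Schwarz_ineq2)
        moreover have "0 \<le> ?c" by (rule Bochner_Integration.integral_nonneg) simp
        ultimately show "norm (LINT y|lebesgue. norm (case (x, y) of (s, t) \<Rightarrow> p s \<bullet> q t))
          \<le> norm (norm (p x) * ?c)"
          by simp
      qed
    qed
  qed
qed

text \<open>The right-hand side is the double integral of \<open>f s \<bullet> g t\<close> over a
  square. Splitting along the diagonal and applying Fubini, with \<open>s\<close> integrated first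
  in one half and \<open>t\<close> first in the other, gives the two terms on the left. Nothing has
  to be differentiated, so integrable \<open>f\<close> and \<open>g\<close> suffice.\<close>

lemma integral_by_parts_indefinite0:
  fixes f g :: "real \<Rightarrow> 'a::euclidean_space"
  assumes f: "f absolutely_integrable_on {a..b}" and g: "g absolutely_integrable_on {a..b}"
  shows "integral {a..b} (\<lambda>t. integral {a..t} f \<bullet> g t + f t \<bullet> integral {a..t} g) =
         integral {a..b} f \<bullet> integral {a..b} g"
proof -
  interpret L: sigma_finite_measure "lebesgue :: real measure" by (rule sigma_finite_lebesgue)
  interpret P: pair_sigma_finite "lebesgue :: real measure" "lebesgue :: real measure" ..
  define p where "p = (\<lambda>t. indicat_real {a..b} t *\<^sub>R f t)"
  define q where "q = (\<lambda>t. indicat_real {a..b} t *\<^sub>R g t)"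
  have p: "integrable lebesgue p" and q: "integrable lebesgue q"
    using f g by (auto simp: p_def q_def set_integrable_def)
  have pint: "(LINT s|lebesgue. p s) = integral {a..b} f" "(LINT s|lebesgue. q s) = integral {a..b} g"
    using set_lebesgue_integral_eq_integral(2)[OF f] set_lebesgue_integral_eq_integral(2)[OF g]
    by (auto simp: p_def q_def set_lebesgue_integral_def)
  have pq: "integrable (lebesgue \<Otimes>\<^sub>M lebesgue) (\<lambda>(s, t). p s \<bullet> q t)"
    by (rule integrable_pair_inner[OF p q])
  have [measurable]: "(\<lambda>x. x) \<in> measurable (lebesgue :: real measure) borel"
    by (intro measurable_completion) auto
  have m[measurable]: "{y \<in> space (lebesgue \<Otimes>\<^sub>M lebesgue). fst y \<le> (snd y :: real)} \<in> sets (lebesgue \<Otimes>\<^sub>M lebesgue)"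
    by measurable
  \<comment> \<open>\<open>s \<le> t\<close> against \<open>t < s\<close>: the diagonal is counted
    exactly once, so that the halves add up to the full integrand at every point.\<close>
  let ?lo = "\<lambda>s t. indicat_real {..t} s *\<^sub>R (p s \<bullet> q t)" 
  let ?hi = "\<lambda>s t. indicat_real {..<s} t *\<^sub>R (p s \<bullet> q t)" 
  have lo: "integrable (lebesgue \<Otimes>\<^sub>M lebesgue) (case_prod ?lo)"
  proof (rule Bochner_Integration.integrable_bound[OF pq])
    have "case_prod ?lo = (\<lambda>y. indicator {y \<in> space (lebesgue \<Otimes>\<^sub>M lebesgue). fst y \<le> (snd y :: real)} y *\<^sub>R (case y of (s, t) \<Rightarrow> p s \<bullet> q t))"
      by (auto simp: fun_eq_iff indicator_def space_pair_measure)
    then show "case_prod ?lo \<in> borel_measurable (lebesgue \<Otimes>\<^sub>M lebesgue)"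
      using m pq by (auto intro!: borel_measurable_scaleR borel_measurable_indicator)
  qed (auto simp: indicator_def)
  have hi_eq: "case_prod ?hi = (\<lambda>y. (case y of (s, t) \<Rightarrow> p s \<bullet> q t) - case_prod ?lo y)"
    by (auto simp: fun_eq_iff indicator_def)
  have hi: "integrable (lebesgue \<Otimes>\<^sub>M lebesgue) (case_prod ?hi)"
    unfolding hi_eq by (intro Bochner_Integration.integrable_diff pq lo)
  have ind: "(LINT s|lebesgue. indicat_real {..t} s *\<^sub>R p s) = integral {a..t} f"
    if "t \<in> {a..b}" for t
  proof -
    have "set_integrable lebesgue {a..t} f"
      by (rule set_integrable_subset[OF f]) (use that in auto)
    then have "(LINT s:{a..t}|lebesgue. f s) = integral {a..t} f"
      by (rule set_lebesgue_integral_eq_integral)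
    moreover have "(\<lambda>s. indicat_real {..t} s *\<^sub>R p s) = (\<lambda>s. indicat_real {a..t} s *\<^sub>R f s)"
      using that by (auto simp: p_def indicator_def fun_eq_iff)
    ultimately show ?thesis by (simp add: set_lebesgue_integral_def)
  qed
  have ind2: "(LINT t|lebesgue. indicat_real {..<s} t *\<^sub>R q t) = integral {a..s} g"
    if "s \<in> {a..b}" for s
  proof -
    have "set_integrable lebesgue {a..<s} g"
      by (rule set_integrable_subset[OF g]) (use that in auto)
    then have "(LINT t:{a..<s}|lebesgue. g t) = integral {a..<s} g"
      by (rule set_lebesgue_integral_eq_integral)
    also have "\<dots> = integral {a..s} g"
      by (rule integral_spike_set) (auto intro: negligible_subset[of "{s}"])
    finally have "(LINT t:{a..<s}|lebesgue. g t) = integral {a..s} g" .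
    moreover have "(\<lambda>t. indicat_real {..<s} t *\<^sub>R q t) = (\<lambda>t. indicat_real {a..<s} t *\<^sub>R g t)"
      using that by (auto simp: q_def indicator_def fun_eq_iff)
    ultimately show ?thesis by (simp add: set_lebesgue_integral_def)
  qed
  have lo_in: "(LINT s|lebesgue. ?lo s t) = indicat_real {a..b} t *\<^sub>R (integral {a..t} f \<bullet> g t)" for t
  proof -
    have "(LINT s|lebesgue. ?lo s t) = (LINT s|lebesgue. (indicat_real {..t} s *\<^sub>R p s) \<bullet> q t)"
      by simp
    also have "\<dots> = (LINT s|lebesgue. indicat_real {..t} s *\<^sub>R p s) \<bullet> q t"
      by (intro integral_inner_left impI integrable_mult_indicator p) auto
    finally show ?thesis
      using ind[of t] by (auto simp: q_def indicator_def)
  qed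
  have hi_in: "(LINT t|lebesgue. ?hi s t) = indicat_real {a..b} s *\<^sub>R (f s \<bullet> integral {a..s} g)" for s
  proof -
    have "(LINT t|lebesgue. ?hi s t) = (LINT t|lebesgue. p s \<bullet> (indicat_real {..<s} t *\<^sub>R q t))"
      by simp
    also have "\<dots> = p s \<bullet> (LINT t|lebesgue. indicat_real {..<s} t *\<^sub>R q t)"
      by (intro integral_inner_right impI integrable_mult_indicator q) auto
    finally show ?thesis
      using ind2[of s] by (auto simp: p_def indicator_def)
  qed
  have fa: "(\<lambda>t. integral {a..t} f \<bullet> g t) absolutely_integrable_on {a..b}"
    by (intro absolutely_integrable_inner_continuous continuous_on_indefinite_integral f g)
  have ga: "(\<lambda>t. f t \<bullet> integral {a..t} g) absolutely_integrable_on {a..b}"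
    using absolutely_integrable_inner_continuous[OF continuous_on_indefinite_integral[OF g] f]
    by (simp add: inner_commute)
  have "integral {a..b} (\<lambda>t. integral {a..t} f \<bullet> g t) = (LINT t|lebesgue. LINT s|lebesgue. ?lo s t)"
    unfolding lo_in using set_lebesgue_integral_eq_integral(2)[OF fa]
    by (simp add: set_lebesgue_integral_def)
  also have "\<dots> = integral\<^sup>L (lebesgue \<Otimes>\<^sub>M lebesgue) (case_prod ?lo)"
    by (rule P.integral_snd[OF lo])
  finally have 1: "integral {a..b} (\<lambda>t. integral {a..t} f \<bullet> g t) = \<dots>" .
  have "integral {a..b} (\<lambda>t. f t \<bullet> integral {a..t} g) = (LINT s|lebesgue. LINT t|lebesgue. ?hi s t)"
    unfolding hi_in using set_lebesgue_integral_eq_integral(2)[OF ga]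
    by (simp add: set_lebesgue_integral_def)
  also have "\<dots> = integral\<^sup>L (lebesgue \<Otimes>\<^sub>M lebesgue) (case_prod ?hi)"
    by (rule P.integral_fst[OF hi])
  finally have 2: "integral {a..b} (\<lambda>t. f t \<bullet> integral {a..t} g) = \<dots>" .
  have "integral {a..b} (\<lambda>t. integral {a..t} f \<bullet> g t + f t \<bullet> integral {a..t} g) =
    integral {a..b} (\<lambda>t. integral {a..t} f \<bullet> g t) + integral {a..b} (\<lambda>t. f t \<bullet> integral {a..t} g)"
    by (intro Henstock_Kurzweil_Integration.integral_add set_lebesgue_integral_eq_integral(1) fa ga)
  also have "\<dots> = integral\<^sup>L (lebesgue \<Otimes>\<^sub>M lebesgue) (\<lambda>(s, t). p s \<bullet> q t)"
    unfolding 1 2 hi_eq Bochner_Integration.integral_diff[OF pq lo] by simp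
  also have "\<dots> = (LINT s|lebesgue. LINT t|lebesgue. p s \<bullet> q t)"
    by (rule P.integral_fst[OF pq, symmetric])
  also have "\<dots> = integral {a..b} f \<bullet> integral {a..b} g"
    using p q pint by simp
  finally show ?thesis .
qed

lemma integral_by_parts_indefinite:
  fixes f g :: "real \<Rightarrow> 'a::euclidean_space"
  assumes f: "f absolutely_integrable_on {a..b}" and g: "g absolutely_integrable_on {a..b}"
    and F: "\<And>t. t \<in> {a..b} \<Longrightarrow> F t = F0 + integral {a..t} f"
    and G: "\<And>t. t \<in> {a..b} \<Longrightarrow> G t = G0 + integral {a..t} g"
    and ab: "a \<le> b"
  shows "(\<lambda>t. F t \<bullet> g t) absolutely_integrable_on {a..b}"
    "(\<lambda>t. f t \<bullet> G t) absolutely_integrable_on {a..b}"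
    "integral {a..b} (\<lambda>t. F t \<bullet> g t) + integral {a..b} (\<lambda>t. f t \<bullet> G t) = F b \<bullet> G b - F0 \<bullet> G0"
proof -
  have "continuous_on {a..b} F \<longleftrightarrow> continuous_on {a..b} (\<lambda>t. F0 + integral {a..t} f)"
    by (rule continuous_on_cong) (auto simp: F)
  then have cF: "continuous_on {a..b} F"
    by (simp add: continuous_on_add continuous_on_indefinite_integral f)
  have "continuous_on {a..b} G \<longleftrightarrow> continuous_on {a..b} (\<lambda>t. G0 + integral {a..t} g)"
    by (rule continuous_on_cong) (auto simp: G)
  then have cG: "continuous_on {a..b} G"
    by (simp add: continuous_on_add continuous_on_indefinite_integral g)
  show 1: "(\<lambda>t. F t \<bullet> g t) absolutely_integrable_on {a..b}"
    by (intro absolutely_integrable_inner_continuous cF g)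
  show 2: "(\<lambda>t. f t \<bullet> G t) absolutely_integrable_on {a..b}"
    using absolutely_integrable_inner_continuous[OF cG f] by (simp add: inner_commute)
  let ?f = "\<lambda>t. integral {a..t} f" and ?g = "\<lambda>t. integral {a..t} g"
  have i: "f integrable_on {a..b}" "g integrable_on {a..b}"
    using f g set_lebesgue_integral_eq_integral(1) by auto
  have i1: "(\<lambda>t. ?f t \<bullet> g t) integrable_on {a..b}" "(\<lambda>t. f t \<bullet> ?g t) integrable_on {a..b}"
    using absolutely_integrable_inner_continuous[OF continuous_on_indefinite_integral[OF f] g]
      absolutely_integrable_inner_continuous[OF continuous_on_indefinite_integral[OF g] f]
      set_lebesgue_integral_eq_integral(1) by (auto simp: inner_commute)
  have i2: "(\<lambda>t. F0 \<bullet> g t) integrable_on {a..b}" "(\<lambda>t. f t \<bullet> G0) integrable_on {a..b}"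
    using integrable_linear[OF i(2) bounded_linear_inner_right[of F0]]
      integrable_linear[OF i(1) bounded_linear_inner_left[of G0]] by (auto simp: o_def)
  have "integral {a..b} (\<lambda>t. F t \<bullet> g t) = integral {a..b} (\<lambda>t. F0 \<bullet> g t + ?f t \<bullet> g t)"
    by (intro integral_cong) (auto simp: F inner_add_left)
  also have "\<dots> = integral {a..b} (\<lambda>t. F0 \<bullet> g t) + integral {a..b} (\<lambda>t. ?f t \<bullet> g t)"
    by (intro Henstock_Kurzweil_Integration.integral_add i1 i2)
  also have "integral {a..b} (\<lambda>t. F0 \<bullet> g t) = F0 \<bullet> integral {a..b} g"
    using integral_linear[OF i(2) bounded_linear_inner_right[of F0]] by (simp add: o_def)
  finally have A: "integral {a..b} (\<lambda>t. F t \<bullet> g t) = F0 \<bullet> integral {a..b} g + integral {a..b} (\<lambda>t. ?f t \<bullet> g t)" .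
  have "integral {a..b} (\<lambda>t. f t \<bullet> G t) = integral {a..b} (\<lambda>t. f t \<bullet> G0 + f t \<bullet> ?g t)"
    by (intro integral_cong) (auto simp: G inner_add_right)
  also have "\<dots> = integral {a..b} (\<lambda>t. f t \<bullet> G0) + integral {a..b} (\<lambda>t. f t \<bullet> ?g t)"
    by (intro Henstock_Kurzweil_Integration.integral_add i1 i2)
  also have "integral {a..b} (\<lambda>t. f t \<bullet> G0) = integral {a..b} f \<bullet> G0"
    using integral_linear[OF i(1) bounded_linear_inner_left[of G0]] by (simp add: o_def)
  finally have B: "integral {a..b} (\<lambda>t. f t \<bullet> G t) = integral {a..b} f \<bullet> G0 + integral {a..b} (\<lambda>t. f t \<bullet> ?g t)" .
  have C: "integral {a..b} (\<lambda>t. ?f t \<bullet> g t) + integral {a..b} (\<lambda>t. f t \<bullet> ?g t) = 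
    integral {a..b} f \<bullet> integral {a..b} g"
    using integral_by_parts_indefinite0[OF f g]
    by (simp add: Henstock_Kurzweil_Integration.integral_add i1)
  show "integral {a..b} (\<lambda>t. F t \<bullet> g t) + integral {a..b} (\<lambda>t. f t \<bullet> G t) = F b \<bullet> G b - F0 \<bullet> G0"
    using A B C ab by (simp add: F G inner_add_left inner_add_right)
qed

section \<open>The du Bois-Reymond lemma\<close>

lemma pos_part_square_deriv:
  "((\<lambda>s::real. (max 0 s)\<^sup>2 / 2) has_real_derivative max 0 s) (at s)"
proof -
  consider "s > 0" | "s < 0" | "s = 0" by linarith
  then show ?thesis
  proof cases
    case 1
    have "((\<lambda>s::real. s\<^sup>2 / 2) has_real_derivative s) (at s)"
      by (auto intro!: derivative_eq_intros)
    then have "((\<lambda>s::real. (max 0 s)\<^sup>2 / 2) has_real_derivative s) (at s)"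
      by (rule has_field_derivative_transform_within_open[of _ _ _ "{0<..}"]) (use 1 in auto)
    then show ?thesis using 1 by simp
  next
    case 2
    have "((\<lambda>s::real. 0) has_real_derivative 0) (at s)"
      by simp
    then have "((\<lambda>s::real. (max 0 s)\<^sup>2 / 2) has_real_derivative 0) (at s)"
      by (rule has_field_derivative_transform_within_open[of _ _ _ "{..<0}"]) (use 2 in auto)
    then show ?thesis using 2 by simp
  next
    case 3
    have "((\<lambda>h::real. (max 0 h)\<^sup>2 / 2 / h) \<longlongrightarrow> 0) (at 0)"
    proof (rule Lim_null_comparison)
      show "\<forall>\<^sub>F h in at 0. norm ((max 0 h)\<^sup>2 / 2 / h) \<le> \<bar>h\<bar>"
        by (rule always_eventually) (auto simp: max_def power2_eq_square)
      show "((\<lambda>h::real. \<bar>h\<bar>) \<longlongrightarrow> 0) (at 0)"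
        by (rule tendsto_eq_intros refl)+ auto
    qed
    then show ?thesis using 3 by (simp add: DERIV_def)
  qed
qed

text \<open>\<open>S\<close> is the second difference, with step \<delta>, of half the squared
  positive part. Its derivative is the hat function on \<open>{-\<delta>..\<delta>}\<close> of
  height \<delta>, whose area \<open>\<delta>\<^sup>2\<close> is the final value of
  \<open>S\<close>. Test functions have to be C^1 only, so a piecewise linear derivative is
  enough.\<close>

lemma smooth_step:
  fixes \<delta> :: real
  assumes "\<delta> > 0"
  obtains S S' :: "real \<Rightarrow> real" where "\<And>s. (S has_real_derivative S' s) (at s)"
    "continuous_on UNIV S'" "\<And>s. 0 \<le> S' s" "\<And>s. s \<notin> {-\<delta>..\<delta>} \<Longrightarrow> S' s = 0" "S' 0 > 0"
    "\<And>s. s \<le> - \<delta> \<Longrightarrow> S s = 0" "\<And>s. \<delta> \<le> s \<Longrightarrow> S s = \<delta>\<^sup>2"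
proof
  let ?k = "\<lambda>s::real. (max 0 s)\<^sup>2 / 2"
  define S where "S = (\<lambda>s. ?k (s + \<delta>) - 2 * ?k s + ?k (s - \<delta>))"
  define S' where "S' = (\<lambda>s. max 0 (s + \<delta>) - 2 * max 0 s + max 0 (s - \<delta>))"
  show "(S has_real_derivative S' s) (at s)" for s
  proof -
    have "((\<lambda>s. ?k (s + c)) has_real_derivative max 0 (s + c)) (at s)" for c
      using DERIV_shift[of ?k "max 0 (s + c)" s c] pos_part_square_deriv by simp
    from this[of \<delta>] this[of 0] this[of "- \<delta>"] show ?thesis
      unfolding S_def S'_def by (intro DERIV_add DERIV_diff DERIV_cmult) simp_all
  qed
  show "continuous_on UNIV S'"
    unfolding S'_def by (intro continuous_intros)
  show "0 \<le> S' s" for s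
    using assms by (auto simp: S'_def max_def)
  show "s \<notin> {-\<delta>..\<delta>} \<Longrightarrow> S' s = 0" for s
    using assms by (auto simp: S'_def max_def)
  show "S' 0 > 0"
    using assms by (auto simp: S'_def max_def)
  show "s \<le> - \<delta> \<Longrightarrow> S s = 0" for s
    using assms by (auto simp: S_def max_def)
  show "\<delta> \<le> s \<Longrightarrow> S s = \<delta>\<^sup>2" for s
    using assms by (auto simp: S_def max_def power2_eq_square field_simps)
qed

lemma test_function_integral:
  assumes "test_function_on T \<phi> \<phi>'" "0 \<le> t"
  shows "integral {0..t} \<phi>' = \<phi> t" 
proof -
  have "(\<phi>' has_integral \<phi> t - \<phi> 0) {0..t}"
    using assms unfolding test_function_on_def
    by (intro fundamental_theorem_of_calculus)
       (auto intro: has_field_derivative_at_within simp flip: has_real_derivative_iff_has_vector_derivative)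
  moreover have "\<phi> 0 = 0"
    using assms unfolding test_function_on_def by force
  ultimately show ?thesis by (simp add: integral_unique)
qed

lemma test_function_continuous:
  assumes "test_function_on T \<phi> \<phi>'"
  shows "continuous_on A \<phi>" "continuous_on A \<phi>'"
proof -
  show "continuous_on A \<phi>"
    using assms unfolding test_function_on_def
    by (meson DERIV_isCont continuous_at_imp_continuous_on)
  show "continuous_on A \<phi>'"
    using assms continuous_on_subset unfolding test_function_on_def by blast
qed

text \<open>The test function climbs one step at \<open>c\<close> and descends the same step at
  \<open>d\<close>, so its derivative is positive only where \<open>h < m\<close> and negative only
  where \<open>h > m\<close>. Having mean zero, the derivative is orthogonal to
  \<open>m - h\<close>; a nonnegative continuous product with integral zero vanishes, yet it is
  positive at \<open>c\<close>.\<close>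

lemma du_Bois_Reymond_less:
  fixes h :: "real \<Rightarrow> real"
  assumes h: "continuous_on {0..T} h"
    and 0: "\<And>\<phi> \<phi>'. test_function_on T \<phi> \<phi>' \<Longrightarrow> integral {0..T} (\<lambda>t. \<phi>' t * h t) = 0"
    and cd: "c \<in> {0<..<T}" "d \<in> {0<..<T}"
  shows "\<not> h c < h d"
proof
  assume less: "h c < h d"
  define m where "m = (h c + h d) / 2"
  have m: "h c < m" "m < h d" using less by (auto simp: m_def)
  have ho: "continuous_on {0<..<T} h"
    by (rule continuous_on_subset[OF h]) auto
  have "open {t \<in> {0<..<T}. h t < m}" "open {t \<in> {0<..<T}. m < h t}"
    using continuous_open_preimage[OF ho, of "{..<m}"] continuous_open_preimage[OF ho, of "{m<..}"]
    by (auto simp: vimage_def Int_def)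
  then obtain e1 e2 where e: "e1 > 0" "e2 > 0" "cball c e1 \<subseteq> {t \<in> {0<..<T}. h t < m}"
    "cball d e2 \<subseteq> {t \<in> {0<..<T}. m < h t}"
    using m cd open_contains_cball by (metis (mono_tags, lifting) mem_Collect_eq)
  define \<delta> where "\<delta> = min e1 e2"
  have \<delta>: "\<delta> > 0" using e by (simp add: \<delta>_def)
  have near_c: "t \<in> {0<..<T} \<and> h t < m" if "t \<in> {c-\<delta>..c+\<delta>}" for t
    using that e(3) by (auto simp: \<delta>_def subset_eq dist_real_def)
  have near_d: "t \<in> {0<..<T} \<and> m < h t" if "t \<in> {d-\<delta>..d+\<delta>}" for t
    using that e(4) by (auto simp: \<delta>_def subset_eq dist_real_def)
  obtain S S' :: "real \<Rightarrow> real" where S: "\<And>s. (S has_real_derivative S' s) (at s)"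
    "continuous_on UNIV S'" "\<And>s. 0 \<le> S' s" "\<And>s. s \<notin> {-\<delta>..\<delta>} \<Longrightarrow> S' s = 0" "S' 0 > 0"
    "\<And>s. s \<le> - \<delta> \<Longrightarrow> S s = 0" "\<And>s. \<delta> \<le> s \<Longrightarrow> S s = \<delta>\<^sup>2"
    using smooth_step[OF \<delta>] by blast
  define \<phi> where "\<phi> = (\<lambda>t. S (t - c) - S (t - d))"
  define \<phi>' where "\<phi>' = (\<lambda>t. S' (t - c) - S' (t - d))"
  have shift: "((\<lambda>t. S (t - c)) has_real_derivative S' (t - c)) (at t)" for c t
    using DERIV_shift[of S "S' (t - c)" t "- c"] S(1) by simp
  have \<phi>'_cont: "continuous_on UNIV \<phi>'"
    unfolding \<phi>'_def by (intro continuous_intros continuous_on_compose2[OF S(2)]) auto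
  have tf: "test_function_on T \<phi> \<phi>'"
    unfolding test_function_on_def
  proof (intro conjI allI \<phi>'_cont exI impI)
    show "(\<phi> has_real_derivative \<phi>' t) (at t)" for t
      unfolding \<phi>_def \<phi>'_def by (intro DERIV_diff shift)
    show "0 < min (c - \<delta>) (d - \<delta>)"
      using near_c[of "c - \<delta>"] near_d[of "d - \<delta>"] \<delta> by auto
    show "max (c + \<delta>) (d + \<delta>) < T"
      using near_c[of "c + \<delta>"] near_d[of "d + \<delta>"] \<delta> by auto
    show "\<phi> t = 0" if "t \<notin> {min (c - \<delta>) (d - \<delta>)..max (c + \<delta>) (d + \<delta>)}" for t
      using that S(6)[of "t - c"] S(6)[of "t - d"] S(7)[of "t - c"] S(7)[of "t - d"]
      by (auto simp: \<phi>_def)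
  qed
  have T: "T > 0" using cd by auto
  have nonneg: "0 \<le> \<phi>' t * (m - h t)" for t
  proof -
    have "0 \<le> S' (t - c) * (m - h t)"
      using near_c[of t] S(3)[of "t - c"] S(4)[of "t - c"] by (cases "t \<in> {c-\<delta>..c+\<delta>}") auto
    moreover have "0 \<le> S' (t - d) * (h t - m)"
      using near_d[of t] S(3)[of "t - d"] S(4)[of "t - d"] by (cases "t \<in> {d-\<delta>..d+\<delta>}") auto
    ultimately show ?thesis by (simp add: \<phi>'_def algebra_simps)
  qed
  have \<phi>c: "continuous_on {0..T} \<phi>'"
    by (rule continuous_on_subset[OF \<phi>'_cont]) auto
  have cont: "continuous_on {0..T} (\<lambda>t. \<phi>' t * (m - h t))"
    by (intro continuous_intros h \<phi>c)
  have "integral {0..T} \<phi>' = \<phi> T"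
    using test_function_integral[OF tf] T by simp
  also have "\<phi> T = 0"
    using tf unfolding test_function_on_def by force
  finally have i0: "integral {0..T} \<phi>' = 0" .
  have "integral {0..T} (\<lambda>t. \<phi>' t * (m - h t)) = integral {0..T} (\<lambda>t. m * \<phi>' t - \<phi>' t * h t)"
    by (simp add: algebra_simps)
  also have "\<dots> = integral {0..T} (\<lambda>t. m * \<phi>' t) - integral {0..T} (\<lambda>t. \<phi>' t * h t)"
    by (intro Henstock_Kurzweil_Integration.integral_diff integrable_continuous_real
        continuous_intros h \<phi>c)
  also have "\<dots> = 0"
    using 0[OF tf] i0 by simp
  finally have "\<forall>t\<in>cbox 0 T. \<phi>' t * (m - h t) = 0"
    using integral_eq_0_iff[of 0 T "\<lambda>t. \<phi>' t * (m - h t)"] cont T nonneg by auto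
  then have "\<phi>' c * (m - h c) = 0" using cd by auto
  moreover have "\<phi>' c > 0"
    using S(5) S(4)[of "c - d"] near_d[of c] m by (fastforce simp: \<phi>'_def)
  ultimately show False using m by simp
qed

lemma du_Bois_Reymond:
  fixes h :: "real \<Rightarrow> real"
  assumes h: "continuous_on {0..T} h" and "T > 0"
    and 0: "\<And>\<phi> \<phi>'. test_function_on T \<phi> \<phi>' \<Longrightarrow> integral {0..T} (\<lambda>t. \<phi>' t * h t) = 0"
    and t: "t \<in> {0..T}"
  shows "h t = h 0"
proof -
  have in_int: "h s = h (T/2)" if "s \<in> {0<..<T}" for s
  proof -
    have "\<not> h s < h (T/2)" "\<not> h (T/2) < h s"
      using that \<open>T > 0\<close> by (intro du_Bois_Reymond_less[OF h 0]; auto)+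
    then show ?thesis by simp
  qed
  have "h s = h (T/2)" if "s \<in> {0..T}" for s
  proof (rule continuous_constant_on_closure[of "{0<..<T}" h])
    show "continuous_on (closure {0<..<T}) h" "s \<in> closure {0<..<T}"
      using h that \<open>T > 0\<close> by auto
  qed (rule in_int)
  then show ?thesis using t \<open>T > 0\<close> by (metis atLeastAtMost_iff order_less_imp_le order_refl)
qed

section \<open>Weakly differentiable functions as indefinite integrals\<close>

lemma absolutely_integrable_scaleR_continuous:
  fixes \<phi> :: "real \<Rightarrow> real" and g :: "real \<Rightarrow> 'a::euclidean_space"
  assumes "continuous_on {a..b} \<phi>" "g absolutely_integrable_on {a..b}"
  shows "(\<lambda>t. \<phi> t *\<^sub>R g t) absolutely_integrable_on {a..b}"
proof (rule absolutely_integrable_bounded_measurable_product[where h = "(*\<^sub>R)"])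
  show "bilinear ((*\<^sub>R) :: real \<Rightarrow> 'a \<Rightarrow> 'a)"
    by (simp add: bilinear_conv_bounded_bilinear bounded_bilinear_scaleR)
  show "\<phi> \<in> borel_measurable (lebesgue_on {a..b})"
    by (rule continuous_imp_measurable_on_sets_lebesgue[OF assms(1)]) auto
  show "bounded (\<phi> ` {a..b})"
    by (rule compact_imp_bounded[OF compact_continuous_image[OF assms(1)]]) auto
qed (use assms in auto)

text \<open>A test function is the indefinite integral of its derivative and vanishes at both ends,
  so no boundary term survives. The argument is componentwise because the integration by parts above
  pairs functions with values in one common space.\<close>

lemma test_function_by_parts:
  fixes g :: "real \<Rightarrow> 'a::euclidean_space"
  assumes tf: "test_function_on T \<phi> \<phi>'" and g: "g absolutely_integrable_on {0..T}" and T: "0 < T"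
    and z: "\<And>t. t \<in> {0..T} \<Longrightarrow> z t = z0 + integral {0..t} g"
  shows "integral {0..T} (\<lambda>t. \<phi>' t *\<^sub>R z t) = - integral {0..T} (\<lambda>t. \<phi> t *\<^sub>R g t)"
proof (rule euclidean_eqI)
  fix b :: 'a
  have c: "continuous_on {0..T} \<phi>'" "continuous_on {0..T} \<phi>"
    using test_function_continuous[OF tf] by auto
  have "continuous_on {0..T} z \<longleftrightarrow> continuous_on {0..T} (\<lambda>t. z0 + integral {0..t} g)"
    by (rule continuous_on_cong) (auto simp: z)
  then have cz: "continuous_on {0..T} z"
    by (simp add: continuous_on_add continuous_on_indefinite_integral g)
  have \<phi>'i: "\<phi>' absolutely_integrable_on {0..T}"
    using c(1) by (rule absolutely_integrable_continuous_real)
  have gb: "(\<lambda>t. g t \<bullet> b) absolutely_integrable_on {0..T}"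
    by (rule absolutely_integrable_component[OF g])
  have *: "integral {0..T} (\<lambda>t. \<phi> t \<bullet> (g t \<bullet> b)) + integral {0..T} (\<lambda>t. \<phi>' t \<bullet> (z t \<bullet> b))
     = \<phi> T \<bullet> (z T \<bullet> b) - 0 \<bullet> (z0 \<bullet> b)"
  proof (rule integral_by_parts_indefinite(3)[OF \<phi>'i gb])
    show "\<phi> t = 0 + integral {0..t} \<phi>'" if "t \<in> {0..T}" for t
      using test_function_integral[OF tf] that by simp
    show "z t \<bullet> b = z0 \<bullet> b + integral {0..t} (\<lambda>t. g t \<bullet> b)" if "t \<in> {0..T}" for t
    proof -
      have "g integrable_on {0..t}"
        using integrable_on_subinterval[of g "{0..T}" 0 t] that set_lebesgue_integral_eq_integral(1)[OF g]
        by auto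
      from integral_linear[OF this bounded_linear_inner_left[of b]]
      show ?thesis using z[OF that] by (simp add: o_def inner_add_left)
    qed
  qed (use T in auto)
  have "\<phi> T = 0" using tf unfolding test_function_on_def by force
  moreover have "integral {0..T} (\<lambda>t. \<phi> t \<bullet> (g t \<bullet> b)) = integral {0..T} (\<lambda>t. \<phi> t *\<^sub>R g t) \<bullet> b"
    using integral_linear[OF set_lebesgue_integral_eq_integral(1)
      [OF absolutely_integrable_scaleR_continuous[OF c(2) g]] bounded_linear_inner_left[of b]]
    by (simp add: o_def)
  moreover have "integral {0..T} (\<lambda>t. \<phi>' t \<bullet> (z t \<bullet> b)) = integral {0..T} (\<lambda>t. \<phi>' t *\<^sub>R z t) \<bullet> b"
    using integral_linear[OF set_lebesgue_integral_eq_integral(1)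
      [OF absolutely_integrable_scaleR_continuous[OF c(1) absolutely_integrable_continuous_real[OF cz]]]
      bounded_linear_inner_left[of b]]
    by (simp add: o_def)
  ultimately show "integral {0..T} (\<lambda>t. \<phi>' t *\<^sub>R z t) \<bullet> b = - integral {0..T} (\<lambda>t. \<phi> t *\<^sub>R g t) \<bullet> b"
    using * by simp
qed

lemma integral_AE_cong:
  fixes f g :: "real \<Rightarrow> 'a::euclidean_space"
  assumes "AE t in lebesgue. t \<in> {a..b} \<longrightarrow> f t = g t"
  shows "integral {a..b} f = integral {a..b} g"
    and "f absolutely_integrable_on {a..b} \<longleftrightarrow> g absolutely_integrable_on {a..b}"
proof -
  obtain N where N: "negligible N" "\<And>t. t \<notin> N \<Longrightarrow> t \<in> {a..b} \<longrightarrow> f t = g t"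
    using assms unfolding eventually_ae_filter_negligible by blast
  show "integral {a..b} f = integral {a..b} g"
    by (rule integral_spike[OF N(1)]) (use N in auto)
  show "f absolutely_integrable_on {a..b} \<longleftrightarrow> g absolutely_integrable_on {a..b}"
    by (rule absolutely_integrable_spike_eq[OF N(1)]) (use N in auto)
qed

text \<open>Subtracting the indefinite integral of \<open>g\<close> leaves a continuous function
  whose weak derivative is zero; each component is then constant by
  \<open>du_Bois_Reymond\<close>.\<close>

lemma W11_continuous_representative:
  fixes f g :: "real \<Rightarrow> real^'n"
  assumes W: "W11_with_derivative T f g" and T: "0 < T"
    and z: "continuous_on {0..T} z" and fz: "AE t in lebesgue. t \<in> {0..T} \<longrightarrow> f t = z t"
    and t: "t \<in> {0..T}"
  shows "z t = z 0 + integral {0..t} g"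
proof (rule euclidean_eqI)
  fix b :: "real^'n"
  have f: "f absolutely_integrable_on {0..T}" and g: "g absolutely_integrable_on {0..T}"
    using W by (auto simp: W11_with_derivative_def)
  let ?G = "\<lambda>t. integral {0..t} g"
  have cG: "continuous_on {0..T} ?G" by (rule continuous_on_indefinite_integral[OF g])
  define h where "h = (\<lambda>t. (z t - ?G t) \<bullet> b)"
  have "h t = h 0"
  proof (rule du_Bois_Reymond[OF _ T _ t])
    show "continuous_on {0..T} h"
      unfolding h_def by (intro continuous_intros z cG)
    fix \<phi> \<phi>'
    assume tf: "test_function_on T \<phi> \<phi>'"
    have c: "continuous_on {0..T} \<phi>'" "continuous_on {0..T} \<phi>"
      using test_function_continuous[OF tf] by auto
    have i: "(\<lambda>t. \<phi>' t *\<^sub>R z t) integrable_on {0..T}" "(\<lambda>t. \<phi>' t *\<^sub>R ?G t) integrable_on {0..T}"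
      by (intro integrable_continuous_real continuous_intros c z cG)+
    have "integral {0..T} (\<lambda>t. \<phi>' t *\<^sub>R z t) = integral {0..T} (\<lambda>t. \<phi>' t *\<^sub>R f t)"
      using fz by (intro integral_AE_cong) (auto elim: eventually_mono)
    also have "\<dots> = (LINT t:{0..T}|lebesgue. \<phi>' t *\<^sub>R f t)"
      by (rule set_lebesgue_integral_eq_integral(2)[OF absolutely_integrable_scaleR_continuous[OF c(1) f], symmetric])
    also have "\<dots> = - (LINT t:{0..T}|lebesgue. \<phi> t *\<^sub>R g t)"
      using W tf by (auto simp: W11_with_derivative_def)
    also have "\<dots> = - integral {0..T} (\<lambda>t. \<phi> t *\<^sub>R g t)"
      by (simp add: set_lebesgue_integral_eq_integral(2)[OF absolutely_integrable_scaleR_continuous[OF c(2) g]])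
    also have "\<dots> = integral {0..T} (\<lambda>t. \<phi>' t *\<^sub>R ?G t)"
      using test_function_by_parts[OF tf g T, of ?G 0] by simp
    finally have "integral {0..T} (\<lambda>t. \<phi>' t *\<^sub>R z t - \<phi>' t *\<^sub>R ?G t) = 0"
      by (simp add: Henstock_Kurzweil_Integration.integral_diff i)
    then have "integral {0..T} (\<lambda>t. \<phi>' t *\<^sub>R z t - \<phi>' t *\<^sub>R ?G t) \<bullet> b = 0" by simp
    then show "integral {0..T} (\<lambda>t. \<phi>' t * h t) = 0"
      using integral_linear[OF integrable_diff[OF i] bounded_linear_inner_left[of b]]
      by (simp add: o_def h_def inner_diff_left right_diff_distrib)
  qed
  then show "z t \<bullet> b = (z 0 + integral {0..t} g) \<bullet> b"
    by (simp add: h_def inner_diff_left inner_add_left)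
qed

lemma W11_values:
  fixes f g :: "real \<Rightarrow> real^'n"
  assumes W: "W11_with_derivative T f g" and T: "0 < T"
    and v: "has_value_at T f 0 w0" "has_value_at T f T w"
  shows "AE t in lebesgue. t \<in> {0..T} \<longrightarrow> f t = w0 + integral {0..t} g"
    and "w = w0 + integral {0..T} g"
proof -
  obtain z where z: "continuous_on {0..T} z" "AE t in lebesgue. t \<in> {0..T} \<longrightarrow> f t = z t" "z 0 = w0"
    using v by (auto simp: has_value_at_def)
  obtain y where y: "continuous_on {0..T} y" "AE t in lebesgue. t \<in> {0..T} \<longrightarrow> f t = y t" "y T = w"
    using v by (auto simp: has_value_at_def)
  note zt = W11_continuous_representative[OF W T z(1,2)]
  note yt = W11_continuous_representative[OF W T y(1,2)]
  show "AE t in lebesgue. t \<in> {0..T} \<longrightarrow> f t = w0 + integral {0..t} g"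
    using z(2) by eventually_elim (use zt z(3) in auto)
  \<comment> \<open>The two values may come from different representatives. These differ by a
    constant and agree almost everywhere on an interval that is not null, so the constant is
    zero.\<close>
  have "AE t in lebesgue. t \<in> {0..T} \<longrightarrow> y 0 = z 0"
    using z(2) y(2)
  proof eventually_elim
    case (elim t)
    then show ?case using zt[of t] yt[of t] by auto
  qed
  then obtain N where N: "negligible N" "\<And>t. t \<notin> N \<Longrightarrow> t \<in> {0..T} \<longrightarrow> y 0 = z 0"
    unfolding eventually_ae_filter_negligible by blast
  have "\<not> negligible {0..T}"
    using T by (simp add: negligible_iff_measure)
  then obtain t where "t \<in> {0..T}" "t \<notin> N"
    using negligible_subset[OF N(1)] by blast
  then have "y 0 = z 0" using N(2) by blast
  then show "w = w0 + integral {0..T} g"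
    using yt[of T] T z y by auto
qed

lemma W11_of_indefinite_integral:
  fixes f g :: "real \<Rightarrow> real^'n"
  assumes g: "g absolutely_integrable_on {0..T}" and T: "0 < T"
    and f: "AE t in lebesgue. t \<in> {0..T} \<longrightarrow> f t = w0 + integral {0..t} g"
  shows "W11_with_derivative T f g" "has_value_at T f 0 w0" "has_value_at T f T (w0 + integral {0..T} g)"
proof -
  define z where "z = (\<lambda>t. w0 + integral {0..t} g)"
  have z: "continuous_on {0..T} z"
    unfolding z_def by (intro continuous_intros continuous_on_indefinite_integral g)
  show "has_value_at T f 0 w0" "has_value_at T f T (w0 + integral {0..T} g)"
    unfolding has_value_at_def using z f by (auto intro!: exI[of _ z] simp: z_def)
  have fa: "f absolutely_integrable_on {0..T}"
    using integral_AE_cong(2)[OF f] absolutely_integrable_continuous_real[OF z] by (simp add: z_def)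
  show "W11_with_derivative T f g"
    unfolding W11_with_derivative_def
  proof (intro conjI fa g allI impI)
    fix \<phi> \<phi>'
    assume tf: "test_function_on T \<phi> \<phi>'"
    have c: "continuous_on {0..T} \<phi>'" "continuous_on {0..T} \<phi>"
      using test_function_continuous[OF tf] by auto
    have "(LINT t:{0..T}|lebesgue. \<phi>' t *\<^sub>R f t) = integral {0..T} (\<lambda>t. \<phi>' t *\<^sub>R f t)"
      by (rule set_lebesgue_integral_eq_integral(2)[OF absolutely_integrable_scaleR_continuous[OF c(1) fa]])
    also have "\<dots> = integral {0..T} (\<lambda>t. \<phi>' t *\<^sub>R z t)"
      using f by (intro integral_AE_cong) (auto elim: eventually_mono simp: z_def)
    also have "\<dots> = - integral {0..T} (\<lambda>t. \<phi> t *\<^sub>R g t)"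
      by (rule test_function_by_parts[OF tf g T]) (simp add: z_def)
    also have "\<dots> = - (LINT t:{0..T}|lebesgue. \<phi> t *\<^sub>R g t)"
      by (simp add: set_lebesgue_integral_eq_integral(2)[OF absolutely_integrable_scaleR_continuous[OF c(2) g]])
    finally show "(LINT t:{0..T}|lebesgue. \<phi>' t *\<^sub>R f t) = - (LINT t:{0..T}|lebesgue. \<phi> t *\<^sub>R g t)" .
  qed
qed

section \<open>Pencils of index one and quadratic forms\<close>

text \<open>Strictly growing kernels would exceed the dimension of the space. The existence is what
  makes the \<open>LEAST\<close> in \<open>stabilization_index\<close> an attained minimum, so that
  a statement about the index yields equality of kernels.\<close>

lemma kernels_of_powers_stabilize:
  fixes f :: "'a::euclidean_space \<Rightarrow> 'a"
  assumes f: "linear f"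
  shows "\<exists>k. {x. (f ^^ (k + 1)) x = 0} = {x. (f ^^ k) x = 0}"
proof (rule ccontr)
  assume no: "\<nexists>k. {x. (f ^^ (k + 1)) x = 0} = {x. (f ^^ k) x = 0}"
  define K where "K = (\<lambda>k. {x. (f ^^ k) x = 0})"
  have lin: "linear (f ^^ k)" for k
  proof (induction k)
    case (Suc k)
    then show ?case unfolding funpow.simps(2) by (rule linear_compose[OF _ f])
  qed (simp add: linear_id[unfolded id_def] id_def)
  have sub: "subspace (K k)" for k
    unfolding K_def by (rule linear_subspace_kernel[OF lin])
  have mono: "K k \<subseteq> K (k + 1)" for k
    using linear_0[OF f] by (auto simp: K_def)
  have "dim (K k) < dim (K (k + 1))" for k
  proof -
    have "dim (K k) \<noteq> dim (K (k + 1))"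
    proof
      assume "dim (K k) = dim (K (k + 1))"
      then have "K k = K (k + 1)" by (intro subspace_dim_equal sub mono) simp
      then show False using no unfolding K_def by metis
    qed
    then show ?thesis using dim_subset[OF mono[of k]] by simp
  qed
  then have "strict_mono (\<lambda>k. dim (K k))"
    by (simp add: strict_mono_Suc_iff)
  then have "k \<le> dim (K k)" for k
    by (rule strict_mono_imp_increasing)
  from this[of "Suc DIM('a)"] show False
    using dim_subset_UNIV[of "K (Suc DIM('a))"] by simp
qed

lemma matrix_inv_mult_eq_iff:
  fixes M :: "real^'n^'n"
  assumes "invertible M"
  shows "matrix_inv M *v x = y \<longleftrightarrow> x = M *v y"
proof -
  have "M ** matrix_inv M = mat 1" "matrix_inv M ** M = mat 1"
    using someI_ex[OF assms[unfolded invertible_def]] by (auto simp: matrix_inv_def)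
  then show ?thesis
    by (metis matrix_vector_mul_assoc matrix_vector_mul_lid)
qed

lemma subspace_im: "subspace (im M)"
  by (simp add: im_def linear_subspace_image)

text \<open>The lift takes its values in the range of \<open>(\<mu>E - A)\<^sup>-\<^sup>1 E\<close>, on which this matrix acts
  bijectively when the index is one.\<close>

lemma index_one_lift:
  fixes E A :: "real^'n^'n"
  assumes "pencil_has_index E A 1"
  obtains X :: "real^'n^'n" where "\<And>w. w \<in> im E \<Longrightarrow> E *v (X *v w) = w"
    "\<And>w. w \<in> im E \<Longrightarrow> A *v (X *v w) \<in> im E"
proof -
  obtain \<mu> where \<mu>: "invertible (\<mu> *\<^sub>R E - A)"
    and index: "stabilization_index (matrix_inv (\<mu> *\<^sub>R E - A) ** E) = 1"
    using assms by (auto simp: pencil_has_index_def)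
  define M where "M = \<mu> *\<^sub>R E - A"
  define f where "f = (\<lambda>v. (matrix_inv M ** E) *v v)"
  have inv: "f x = y \<longleftrightarrow> E *v x = M *v y" for x y
    using matrix_inv_mult_eq_iff[OF \<mu>] by (simp add: f_def M_def flip: matrix_vector_mul_assoc)
  have lin: "linear f" by (simp add: f_def)
  have "{x. (f ^^ (1 + 1)) x = 0} = {x. (f ^^ 1) x = 0}"
    using LeastI_ex[OF kernels_of_powers_stabilize[OF lin]] index
    unfolding stabilization_index_def f_def M_def by metis
  \<comment> \<open>Equal kernels of the first two powers make \<open>f\<close> injective on its
    range, and by dimension bijective there.\<close>
  then have ker: "f x = 0" if "f (f x) = 0" for x
    using that by auto
  have "inj_on f (range f)"
    using lin ker by (auto simp: linear_injective_on_subspace_0 linear_subspace_image)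
  then have "dim (f ` range f) = dim (range f)"
    using lin by (intro dim_image_eq) (auto simp: span_eq_iff[THEN iffD2] linear_subspace_image)
  then have surj: "f ` range f = range f"
    using lin by (intro subspace_dim_equal) (auto simp: linear_subspace_image)
  have "inj_on ((*v) E) (span (range f))"
  proof -
    have "r = 0" if "r \<in> range f" "E *v r = 0" for r
      using that ker inv[of r 0] by (auto simp: matrix_vector_mult_0_right)
    then show ?thesis
      using lin by (auto simp: linear_injective_on_subspace_0 linear_subspace_image span_eq_iff[THEN iffD2])
  qed
  then obtain g where g: "linear g" "\<And>x. x \<in> range f \<Longrightarrow> g (E *v x) = x"
    using linear_inj_on_left_inverse[of "(*v) E" "range f"] by (metis matrix_vector_mul_linear span_base)
  have *: "\<exists>s. matrix g *v w = f s \<and> E *v (matrix g *v w) = w" if "w \<in> im E" for w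
  proof -
    obtain x where x: "w = E *v x" using \<open>w \<in> im E\<close> by (auto simp: im_def)
    obtain r where r: "r \<in> range f" "f r = f x" using surj by (metis imageE rangeI)
    then have "E *v r = w" using x inv by metis
    then show ?thesis
      using g(2)[OF r(1)] r(1) g(1) by (auto simp: matrix_works)
  qed
  show thesis
  proof
    fix w assume w: "w \<in> im E"
    then show "E *v (matrix g *v w) = w" using * by blast
    obtain s where s: "matrix g *v w = f s" "E *v (matrix g *v w) = w" using *[OF w] by blast
    \<comment> \<open>\<open>A\<close> is \<open>\<mu> *\<^sub>R E - M\<close>, and \<open>M\<close>
      maps \<open>f s\<close> to \<open>E *v s\<close>; so lifts taken in the range of
      \<open>f\<close> have their image under \<open>A\<close> in \<open>im E\<close>.\<close>
    have "M *v (matrix g *v w) = E *v s"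
      using s(1) inv[of s] by metis
    then have "A *v (matrix g *v w) = \<mu> *\<^sub>R w - E *v s"
      using s(2) by (simp add: M_def matrix_vector_mult_diff_rdistrib scaleR_matrix_vector_assoc [symmetric] algebra_simps)
    also have "\<dots> \<in> im E"
      using w by (intro subspace_diff subspace_scale subspace_im) (auto simp: im_def)
    finally show "A *v (matrix g *v w) \<in> im E" .
  qed
qed

section \<open>Semidefinite forms and distance to a kernel\<close>

text \<open>On the orthogonal complement of its kernel \<open>M\<close> is injective, hence bounded
  below by some \<open>e > 0\<close> in finite dimension; the constant is
  \<open>1 / e\<^sup>2\<close>.\<close>

lemma infdist_ker_bound:
  fixes M :: "real^'k^'n"
  obtains c where "0 \<le> c" "\<And>x. (infdist x (ker M))\<^sup>2 \<le> c * (norm (M *v x))\<^sup>2"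
proof -
  let ?K = "ker M"
  have sK: "subspace ?K"
    unfolding ker_def by (rule linear_subspace_kernel) simp
  define W where "W = {y. \<forall>x \<in> span ?K. orthogonal x y}"
  have sW: "subspace W"
    unfolding W_def by (rule subspace_orthogonal_to_vectors)
  have "x = 0" if "x \<in> W" "M *v x = 0" for x
  proof -
    have "x \<in> span ?K" using that by (auto simp: ker_def intro: span_base)
    then show ?thesis using that by (auto simp: W_def orthogonal_self)
  qed
  then have "\<exists>e>0. \<forall>x\<in>W. norm (M *v x) \<ge> e * norm x"
    by (intro injective_imp_isometric closed_subspace sW) auto
  then obtain e where e: "e > 0" "\<And>x. x \<in> W \<Longrightarrow> norm (M *v x) \<ge> e * norm x" by blast
  show thesis
  proof
    fix x
    obtain y z where yz: "y \<in> span ?K" "\<And>w. w \<in> span ?K \<Longrightarrow> orthogonal z w" "x = y + z"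
      using orthogonal_subspace_decomp_exists[of ?K x] by metis
    have y: "y \<in> ?K" using yz(1) sK by (simp add: span_eq_iff[THEN iffD2])
    have z: "z \<in> W" using yz(2) by (auto simp: W_def orthogonal_commute)
    have "infdist x ?K \<le> norm z"
      using infdist_le[OF y, of x] yz(3) by (simp add: dist_norm)
    then have "(e * infdist x ?K)\<^sup>2 \<le> (norm (M *v x))\<^sup>2"
    proof (intro power_mono)
      assume "infdist x ?K \<le> norm z"
      then have "e * infdist x ?K \<le> e * norm z" using e by simp
      also have "\<dots> \<le> norm (M *v z)" by (rule e(2)[OF z])
      also have "M *v z = M *v x" using y yz(3) by (simp add: ker_def matrix_vector_right_distrib)
      finally show "e * infdist x ?K \<le> norm (M *v x)" .
    qed (use e infdist_nonneg[of x "ker M"] in auto)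
    then show "(infdist x ?K)\<^sup>2 \<le> (1 / e\<^sup>2) * (norm (M *v x))\<^sup>2"
      using e by (simp add: field_simps power_mult_distrib)
  qed simp
qed

lemma symmetric_psd_inner_commute:
  assumes "symmetric_psd P"
  shows "x \<bullet> (P *v y) = (P *v x) \<bullet> y"
  using assms dot_lmul_matrix[of x P y] by (metis symmetric_psd_def transpose_matrix_vector)

text \<open>The form is nonnegative at the gradient step
  \<open>y - (1/K) *\<^sub>R (P *v y)\<close>, where \<open>K\<close> bounds the operator norm of
  \<open>P\<close>. Expanding gives the estimate with constant \<open>K\<close> and without a matrix
  square root.\<close>

lemma symmetric_psd_norm_bound:
  fixes P :: "real^'n^'n"
  assumes P: "symmetric_psd P"
  obtains c where "0 \<le> c" "\<And>y. (norm (P *v y))\<^sup>2 \<le> c * (y \<bullet> (P *v y))"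
proof -
  obtain K where K: "K > 0" "\<And>y. norm (P *v y) \<le> norm y * K"
    using bounded_linear.pos_bounded[of "(*v) P"] by auto
  show thesis
  proof
    fix y
    define r where "r = P *v y"
    have "0 \<le> (y - (1/K) *\<^sub>R r) \<bullet> (P *v (y - (1/K) *\<^sub>R r))"
      using P by (simp add: symmetric_psd_def)
    also have "\<dots> = y \<bullet> r - 2 / K * (r \<bullet> r) + (1/K)\<^sup>2 * (r \<bullet> (P *v r))"
      using symmetric_psd_inner_commute[OF P, of y r]
      by (simp add: matrix_vector_mult_diff_distrib matrix_vector_mult_scaleR inner_diff_left
          inner_diff_right r_def[symmetric] power2_eq_square algebra_simps)
    also have "\<dots> \<le> y \<bullet> r - 2 / K * (r \<bullet> r) + (1/K)\<^sup>2 * (K * (r \<bullet> r))"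
    proof -
      have "r \<bullet> (P *v r) \<le> norm r * norm (P *v r)" by (rule norm_cauchy_schwarz)
      also have "\<dots> \<le> norm r * (norm r * K)" by (intro mult_left_mono K) auto
      finally show ?thesis
        by (intro add_left_mono mult_left_mono) (auto simp: dot_square_norm power2_eq_square mult_ac)
    qed
    also have "\<dots> = y \<bullet> r - 1 / K * (r \<bullet> r)"
      using K by (simp add: field_simps power2_eq_square)
    finally show "(norm (P *v y))\<^sup>2 \<le> K * (y \<bullet> (P *v y))"
      using K by (simp add: field_simps r_def dot_square_norm)
  qed (use K in simp)
qed

text \<open>The parallelogram identity without its nonnegative term at \<open>x - y\<close>.\<close>

lemma symmetric_psd_add_bound:
  assumes P: "symmetric_psd P"
  shows "(x + y) \<bullet> (P *v (x + y)) \<le> 2 * (x \<bullet> (P *v x)) + 2 * (y \<bullet> (P *v y))"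
proof -
  have "0 \<le> (x - y) \<bullet> (P *v (x - y))"
    using P by (simp add: symmetric_psd_def)
  then show ?thesis
    by (simp add: matrix_vector_mult_diff_distrib matrix_vector_right_distrib algebra_simps)
qed

text \<open>The defect of convexity is exactly \<open>a * (1 - a)\<close> times the form at
  \<open>x - y\<close>.\<close>

lemma symmetric_psd_convex:
  assumes P: "symmetric_psd P" and a: "0 \<le> a" "a \<le> 1"
  shows "((1 - a) *\<^sub>R x + a *\<^sub>R y) \<bullet> (P *v ((1 - a) *\<^sub>R x + a *\<^sub>R y)) \<le>
         (1 - a) * (x \<bullet> (P *v x)) + a * (y \<bullet> (P *v y))"
proof -
  have "0 \<le> (a * (1 - a)) * ((x - y) \<bullet> (P *v (x - y)))"
    using P a by (simp add: symmetric_psd_def)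
  then show ?thesis
    by (simp add: matrix_vector_mult_diff_distrib matrix_vector_right_distrib matrix_vector_mult_scaleR
        algebra_simps)
qed

section \<open>Linear flows and continuous majorants\<close>

text \<open>\<open>Y s\<close> is the exponential of \<open>s\<close> times \<open>f\<close>, for
  times of either sign. An invariant subspace contains all partial sums of the series, and it is
  closed, so it contains the limit.\<close>

lemma linear_flow:
  fixes f :: "'a::euclidean_space \<Rightarrow> 'a"
  assumes f: "linear f"
  obtains Y :: "real \<Rightarrow> 'a \<Rightarrow> 'a" and K :: real where
    "\<And>t v. ((\<lambda>s. Y s v) has_vector_derivative f (Y t v)) (at t)"
    "\<And>v. Y 0 v = v"
    "\<And>V s v. subspace V \<Longrightarrow> f ` V \<subseteq> V \<Longrightarrow> v \<in> V \<Longrightarrow> Y s v \<in> V"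
    "\<And>s v. norm (Y s v) \<le> exp (K * \<bar>s\<bar>) * norm v" "0 \<le> K"
proof -
  obtain K where K: "K > 0" "\<And>x. norm (f x) \<le> norm x * K"
    using bounded_linear.pos_bounded f linear_conv_bounded_linear by metis
  have nf: "norm ((f ^^ k) v) \<le> K ^ k * norm v" for k v
  proof (induction k)
    case (Suc k)
    have "norm ((f ^^ Suc k) v) \<le> norm ((f ^^ k) v) * K" using K by simp
    also have "\<dots> \<le> (K ^ k * norm v) * K" using Suc K by (intro mult_right_mono) auto
    finally show ?case by (simp add: algebra_simps)
  qed simp
  define a where "a = (\<lambda>s v k. (s ^ k / fact k) *\<^sub>R (f ^^ k) v)"
  define Y where "Y = (\<lambda>s v. \<Sum>k. a s v k)"
  have na: "norm (a s v k) \<le> (inverse (fact k) * (K * \<bar>s\<bar>) ^ k) * norm v" for s v k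
  proof -
    have "norm (a s v k) = (\<bar>s\<bar> ^ k / fact k) * norm ((f ^^ k) v)"
      by (simp add: a_def power_abs)
    also have "\<dots> \<le> (\<bar>s\<bar> ^ k / fact k) * (K ^ k * norm v)"
      by (intro mult_left_mono nf) auto
    finally show ?thesis by (simp add: field_simps power_mult_distrib)
  qed
  have es: "(\<lambda>k. (inverse (fact k) * (K * \<bar>s\<bar>) ^ k) * norm v) sums (exp (K * \<bar>s\<bar>) * norm v)" for s v
    using exp_converges[of "K * \<bar>s\<bar>"] by (intro sums_mult2) (simp add: divide_inverse mult_ac)
  have sn: "summable (\<lambda>k. norm (a s v k))" for s v
    by (rule summable_comparison_test'[OF sums_summable[OF es[of s v]]]) (use na in auto)
  have sa: "summable (a s v)" for s v
    by (rule summable_norm_cancel[OF sn])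
  have Yb: "norm (Y s v) \<le> exp (K * \<bar>s\<bar>) * norm v" for s v
  proof -
    have "norm (Y s v) \<le> (\<Sum>k. norm (a s v k))"
      unfolding Y_def by (rule summable_norm[OF sn])
    also have "\<dots> \<le> exp (K * \<bar>s\<bar>) * norm v"
      using suminf_le[OF na sn sums_summable[OF es]] sums_unique[OF es] by metis
    finally show ?thesis .
  qed
  have deriv: "((\<lambda>s. Y s v) has_vector_derivative f (Y t v)) (at t)" for t v
    unfolding has_vector_derivative_def
  proof (subst has_derivative_componentwise_within, intro ballI)
    fix b :: 'a
    assume "b \<in> Basis"
    define c where "c = (\<lambda>k. ((f ^^ k) v \<bullet> b) / fact k)"
    have cs: "c k * s ^ k = a s v k \<bullet> b" for k s
      by (simp add: c_def a_def)
    have sc: "summable (\<lambda>k. c k * s ^ k)" for s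
      unfolding cs by (rule bounded_linear.summable[OF bounded_linear_inner_left sa])
    have Yc: "Y s v \<bullet> b = (\<Sum>k. c k * s ^ k)" for s
      unfolding cs Y_def by (rule bounded_linear.suminf[OF bounded_linear_inner_left sa])
    have bl: "bounded_linear (\<lambda>y. f y \<bullet> b)"
      using f by (intro bounded_linear_compose[OF bounded_linear_inner_left])
        (simp add: linear_conv_bounded_linear)
    have d: "diffs c k * t ^ k = f (a t v k) \<bullet> b" for k
    proof -
      have "diffs c k = (f ((f ^^ k) v) \<bullet> b) / fact k"
        by (simp add: diffs_def c_def del: of_nat_Suc)
      then show ?thesis using linear_scale[OF f] by (simp add: a_def)
    qed
    \<comment> \<open>Each coordinate is an everywhere convergent real power series and can be
      differentiated termwise; the coefficient shift \<open>diffs\<close> amounts to one more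
      application of \<open>f\<close>.\<close>
    have "((\<lambda>s. Y s v \<bullet> b) has_real_derivative (\<Sum>k. diffs c k * t ^ k)) (at t)"
      unfolding Yc by (rule termdiffs_strong_converges_everywhere[OF sc])
    also have "(\<Sum>k. diffs c k * t ^ k) = f (Y t v) \<bullet> b"
      unfolding d Y_def by (rule bounded_linear.suminf[OF bl sa, symmetric])
    finally show "((\<lambda>s. Y s v \<bullet> b) has_derivative (\<lambda>h. (h *\<^sub>R f (Y t v)) \<bullet> b)) (at t)"
      by (simp add: has_field_derivative_def mult_commute_abs)
  qed
  have Y0: "Y 0 v = v" for v
  proof -
    have "Y 0 v = (\<Sum>k\<in>{0}. a 0 v k)"
      unfolding Y_def by (rule suminf_finite) (auto simp: a_def)
    then show ?thesis by (simp add: a_def)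
  qed
  have YV: "Y s v \<in> V" if V: "subspace V" "f ` V \<subseteq> V" "v \<in> V" for V s v
  proof (rule closed_sequentially[OF closed_subspace[OF V(1)]])
    have "(f ^^ k) v \<in> V" for k
      by (induction k) (use V in auto)
    then show "(\<Sum>k<n. a s v k) \<in> V" for n
      by (intro subspace_sum V(1)) (auto simp: a_def intro: subspace_scale V(1))
    show "(\<lambda>n. \<Sum>k<n. a s v k) \<longlonglongrightarrow> Y s v"
      using summable_sums[OF sa] by (simp add: sums_def Y_def)
  qed
  show thesis
    by (rule that[OF deriv Y0 YV Yb]) (use K in auto)
qed

text \<open>The candidate is twice the inverse of the supremum of the radii \<open>\<rho> \<le> 1\<close> for which
  \<open>D (1/\<rho>)\<close> covers the \<open>\<rho>\<close>-neighbourhood; this supremum is 1-Lipschitz.\<close>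

lemma continuous_majorant:
  fixes S :: "'a::metric_space set" and D :: "real \<Rightarrow> 'a set"
  assumes mono: "\<And>r s. r \<le> s \<Longrightarrow> D r \<subseteq> D s"
    and loc: "\<And>x. x \<in> S \<Longrightarrow> \<exists>e>0. \<exists>r. ball x e \<inter> S \<subseteq> D r"
  obtains g :: "'a \<Rightarrow> real" where "continuous_on S g" "\<And>x. x \<in> S \<Longrightarrow> 0 \<le> g x"
    "\<And>x. x \<in> S \<Longrightarrow> x \<in> D (g x)"
proof -
  define A where "A = (\<lambda>x. {\<rho>. 0 < \<rho> \<and> \<rho> \<le> 1 \<and> ball x \<rho> \<inter> S \<subseteq> D (1/\<rho>)})"
  define h where "h = (\<lambda>x. Sup (A x))"
  have bdd: "bdd_above (A x)" for x
    by (rule bdd_aboveI[of _ 1]) (auto simp: A_def)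
  have ne: "A x \<noteq> {}" if x: "x \<in> S" for x
  proof -
    obtain e r where er: "e > 0" "ball x e \<inter> S \<subseteq> D r" using loc[OF x] by blast
    \<comment> \<open>The last term forces \<open>r \<le> 1/\<rho>\<close>, so that
      \<open>D r\<close> is contained in \<open>D (1/\<rho>)\<close>; the \<open>max\<close> guards
      against \<open>r\<close> that is not positive.\<close>
    define \<rho> where "\<rho> = min 1 (min e (1 / max 1 r))"
    have \<rho>: "0 < \<rho>" "\<rho> \<le> 1" "\<rho> \<le> e" "\<rho> \<le> 1 / max 1 r" using er by (auto simp: \<rho>_def)
    have "m \<le> 1/\<rho>" if "\<rho> \<le> 1/m" "0 < m" for m
      using that \<rho>(1) by (simp add: field_simps)
    from this[OF \<rho>(4)] have "r \<le> 1/\<rho>" by simp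
    then have "ball x \<rho> \<inter> S \<subseteq> D (1/\<rho>)"
      using er(2) \<rho>(3) mono by (fastforce simp: subset_eq)
    then have "\<rho> \<in> A x" using \<rho> by (auto simp: A_def)
    then show ?thesis by blast
  qed
  have hpos: "0 < h x" if x: "x \<in> S" for x
  proof -
    obtain \<rho> where \<rho>: "\<rho> \<in> A x" using ne[OF x] by blast
    then have "\<rho> \<le> h x" unfolding h_def by (rule cSup_upper[OF _ bdd])
    then show ?thesis using \<rho> by (auto simp: A_def)
  qed
  have lip: "h x \<le> h y + dist x y" if "x \<in> S" "y \<in> S" for x y
  proof -
    have "Sup (A x) \<le> h y + dist x y"
    proof (rule cSup_least[OF ne[OF that(1)]])
      fix \<rho> assume \<rho>: "\<rho> \<in> A x"
      show "\<rho> \<le> h y + dist x y"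
      proof (cases "dist x y < \<rho>")
        case True
        \<comment> \<open>Moving the centre to \<open>y\<close> costs \<open>dist x y\<close> of the
          radius, while the admissible parameter \<open>1/?\<sigma>\<close> only grows. This makes
          the supremum 1-Lipschitz.\<close>
        let ?\<sigma> = "\<rho> - dist x y"
        have "ball y ?\<sigma> \<subseteq> ball x \<rho>"
        proof
          fix z assume "z \<in> ball y ?\<sigma>"
          then show "z \<in> ball x \<rho>" using dist_triangle[of x z y] by simp
        qed
        moreover have "D (1/\<rho>) \<subseteq> D (1/?\<sigma>)"
          using True \<rho> by (intro mono frac_le) (auto simp: A_def)
        moreover have "?\<sigma> \<le> 1"
          using \<rho> zero_le_dist[of x y] by (simp add: A_def del: zero_le_dist)
        ultimately have "?\<sigma> \<in> A y"
          using \<rho> True by (auto simp: A_def)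
        then have "?\<sigma> \<le> h y" unfolding h_def by (rule cSup_upper[OF _ bdd])
        then show ?thesis by simp
      next
        case False
        then show ?thesis using hpos[OF that(2)] by simp
      qed
    qed
    then show ?thesis by (simp add: h_def)
  qed
  have cont: "continuous_on S h"
    unfolding continuous_on_iff
  proof (intro ballI allI impI)
    fix x e assume "x \<in> S" "(0::real) < e"
    moreover have "dist (h y) (h x) \<le> dist y x" if "y \<in> S" for y
      using lip[OF that \<open>x \<in> S\<close>] lip[OF \<open>x \<in> S\<close> that] by (auto simp: dist_real_def dist_commute)
    ultimately show "\<exists>d>0. \<forall>x'\<in>S. dist x' x < d \<longrightarrow> dist (h x') (h x) < e"
      by (meson le_less_trans)
  qed
  show thesis
  proof (rule that[of "\<lambda>x. 2 / h x"])
    show "continuous_on S (\<lambda>x. 2 / h x)"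
      by (intro continuous_intros cont) (use hpos in force)
    fix x assume x: "x \<in> S"
    show "0 \<le> 2 / h x" using hpos[OF x] by simp
    \<comment> \<open>The supremum need not be attained. Half of it lies strictly below an
      admissible radius, which explains the factor two.\<close>
    have "h x / 2 < Sup (A x)" using hpos[OF x] by (simp add: h_def)
    then obtain \<rho> where \<rho>: "\<rho> \<in> A x" "h x / 2 < \<rho>"
      using less_cSup_iff[OF ne[OF x] bdd] by blast
    then have "1/\<rho> \<le> 2 / h x" using hpos[OF x] by (auto simp: A_def field_simps)
    moreover have "x \<in> D (1/\<rho>)" using \<rho> x by (auto simp: A_def)
    ultimately show "x \<in> D (2 / h x)" using mono by blast
  qed
qed

section \<open>Trajectories\<close>

definition glue :: "real \<Rightarrow> (real \<Rightarrow> 'a) \<Rightarrow> (real \<Rightarrow> 'a) \<Rightarrow> real \<Rightarrow> 'a" where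
  "glue s f g = (\<lambda>\<sigma>. if \<sigma> \<le> s then f \<sigma> else g (\<sigma> - s))"

lemma glue_compose: "(\<lambda>\<sigma>. h (glue s f g \<sigma>)) = glue s (\<lambda>\<sigma>. h (f \<sigma>)) (\<lambda>\<sigma>. h (g \<sigma>))"
  by (auto simp: glue_def)

lemma glue_compose2:
  "(\<lambda>\<sigma>. h (glue s f g \<sigma>) (glue s f' g' \<sigma>)) = glue s (\<lambda>\<sigma>. h (f \<sigma>) (f' \<sigma>)) (\<lambda>\<sigma>. h (g \<sigma>) (g' \<sigma>))"
  by (auto simp: glue_def)

lemma glue_integral:
  fixes f g :: "real \<Rightarrow> 'a::euclidean_space"
  assumes f: "f absolutely_integrable_on {0..s}" and g: "g absolutely_integrable_on {0..t}"
    and "0 \<le> s" "0 \<le> t"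
  shows "glue s f g absolutely_integrable_on {0..s + t}"
    "integral {0..s + t} (glue s f g) = integral {0..s} f + integral {0..t} g"
proof -
  have 1: "glue s f g absolutely_integrable_on {0..s}" "integral {0..s} (glue s f g) = integral {0..s} f"
    using f absolutely_integrable_spike_eq[of "{}" "{0..s}" f "glue s f g"]
    by (auto simp: glue_def intro!: integral_cong)
  have shift: "((\<lambda>\<sigma>. h (\<sigma> - s)) has_integral I) {s..s + t}" if "(h has_integral I) {0..t}"
    for h :: "real \<Rightarrow> 'b::euclidean_space" and I
    using has_integral_shift_real_ivl[OF that, of "- s"] by (simp add: add.commute)
  have gi: "g integrable_on {0..t}" "(\<lambda>\<sigma>. norm (g \<sigma>)) integrable_on {0..t}"
    using g by (auto simp: absolutely_integrable_on_def)
  have gs: "(\<lambda>\<sigma>. g (\<sigma> - s)) absolutely_integrable_on {s..s + t}"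
    unfolding absolutely_integrable_on_def
    using shift[OF integrable_integral[OF gi(1)]] shift[OF integrable_integral[OF gi(2)]]
    by (auto simp: integrable_on_def)
  have 2: "glue s f g absolutely_integrable_on {s..s + t}"
    using absolutely_integrable_spike_eq[of "{s}" "{s..s + t}" "\<lambda>\<sigma>. g (\<sigma> - s)" "glue s f g"] gs
    by (auto simp: glue_def)
  have "integral {s..s + t} (glue s f g) = integral {s..s + t} (\<lambda>\<sigma>. g (\<sigma> - s))"
    by (rule integral_spike[of "{s}"]) (auto simp: glue_def)
  also have "\<dots> = integral {0..t} g"
    using shift[OF integrable_integral[OF gi(1)]] by (rule integral_unique)
  finally have 3: "integral {s..s + t} (glue s f g) = integral {0..t} g" .
  show *: "glue s f g absolutely_integrable_on {0..s + t}"
    by (rule absolutely_integrable_on_combine[OF 1(1) 2]) (use assms in auto)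
  have "integral {0..s} (glue s f g) + integral {s..s + t} (glue s f g) = integral {0..s + t} (glue s f g)"
    by (rule Henstock_Kurzweil_Integration.integral_combine)
      (use assms set_lebesgue_integral_eq_integral(1)[OF *] in auto)
  then show "integral {0..s + t} (glue s f g) = integral {0..s} f + integral {0..t} g"
    using 1(2) 3 by simp
qed

text \<open>\<open>P\<close> depends on time because the integral equation does; the exceptional set
  of the second piece is translated by \<open>s\<close> and stays null.\<close>

lemma glue_AE:
  assumes f: "AE \<sigma> in lebesgue. \<sigma> \<in> {0..s} \<longrightarrow> P \<sigma> (f \<sigma>)"
    and g: "AE \<sigma> in lebesgue. \<sigma> \<in> {0..t} \<longrightarrow> P (s + \<sigma>) (g \<sigma>)"
  shows "AE \<sigma> in lebesgue. \<sigma> \<in> {0..s + t} \<longrightarrow> P \<sigma> (glue s f g \<sigma>)"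
proof -
  obtain N where N: "negligible N" "\<And>\<sigma>. \<sigma> \<notin> N \<Longrightarrow> \<sigma> \<in> {0..s} \<longrightarrow> P \<sigma> (f \<sigma>)"
    using f unfolding eventually_ae_filter_negligible by blast
  obtain M where M: "negligible M" "\<And>\<sigma>. \<sigma> \<notin> M \<Longrightarrow> \<sigma> \<in> {0..t} \<longrightarrow> P (s + \<sigma>) (g \<sigma>)"
    using g unfolding eventually_ae_filter_negligible by blast
  have "negligible (N \<union> (+) s ` M)"
    by (intro negligible_Un N negligible_translation M)
  moreover have "\<sigma> \<in> {0..s + t} \<longrightarrow> P \<sigma> (glue s f g \<sigma>)" if "\<sigma> \<notin> N \<union> (+) s ` M" for \<sigma>
  proof -
    have "\<sigma> - s \<notin> M" using that by (metis UnI2 add_diff_cancel_left' diff_add_cancel add.commute imageI)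
    then show ?thesis using N(2)[of \<sigma>] M(2)[of "\<sigma> - s"] that by (auto simp: glue_def)
  qed
  ultimately show ?thesis unfolding eventually_ae_filter_negligible by blast
qed

section \<open>Trajectories in integrated form\<close>

lemma absolutely_integrable_matrix_vector:
  fixes x :: "real \<Rightarrow> real^'k"
  assumes "x absolutely_integrable_on S"
  shows "(\<lambda>t. M *v x t) absolutely_integrable_on S"
  using absolutely_integrable_linear[OF assms, of "(*v) M"] by (simp add: o_def)

text \<open>The end values of \<open>E x\<close> are parameters, and the differential equation is
  replaced by its integral. Duration zero is allowed, so that joining and waiting need no case
  distinction. The integral equation holds almost everywhere only, since \<open>x\<close> is
  determined up to null sets.\<close>

definition trajectory ::
    "real^'n^'n \<Rightarrow> real^'n^'n \<Rightarrow> real^'m^'n \<Rightarrow> (real^'m) set \<Rightarrow> real \<Rightarrow> real^'n \<Rightarrow> real^'n \<Rightarrow>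
     (real \<Rightarrow> real^'m) \<Rightarrow> (real \<Rightarrow> real^'n) \<Rightarrow> bool" where
  "trajectory E A B U t w w' u x \<longleftrightarrow>
     0 \<le> t \<and> w \<in> im E \<and> u absolutely_integrable_on {0..t} \<and> x absolutely_integrable_on {0..t} \<and>
     (AE s in lebesgue. s \<in> {0..t} \<longrightarrow> u s \<in> U) \<and>
     (AE s in lebesgue. s \<in> {0..t} \<longrightarrow> E *v x s = w + integral {0..s} (\<lambda>r. A *v x r + B *v u r)) \<and>
     w' = w + integral {0..t} (\<lambda>r. A *v x r + B *v u r)"

lemma absolutely_integrable_rhs:
  fixes x :: "real \<Rightarrow> real^'n" and u :: "real \<Rightarrow> real^'m"
  assumes "u absolutely_integrable_on S" "x absolutely_integrable_on S"
  shows "(\<lambda>r. A *v x r + B *v u r) absolutely_integrable_on S"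
  using assms by (intro set_integral_add absolutely_integrable_matrix_vector)

text \<open>The bridge to weak derivatives: an indefinite integral is a W11 function with the right
  boundary values, and conversely. Everything built later works on the integral equation
  alone.\<close>

lemma trajectory_iff_solution:
  assumes t: "0 < t"
  shows "trajectory E A B U t w w' u x \<longleftrightarrow> w \<in> im E \<and> admissible_control U t u \<and> is_solution E A B t u x \<and>
    has_value_at t (\<lambda>s. E *v x s) 0 w \<and> has_value_at t (\<lambda>s. E *v x s) t w'"
proof
  assume *: "trajectory E A B U t w w' u x"
  let ?g = "\<lambda>r. A *v x r + B *v u r"
  have g: "?g absolutely_integrable_on {0..t}"
    using * by (intro absolutely_integrable_rhs) (auto simp: trajectory_def)
  have "AE s in lebesgue. s \<in> {0..t} \<longrightarrow> E *v x s = w + integral {0..s} ?g"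
    using * by (simp add: trajectory_def)
  note W = W11_of_indefinite_integral[OF g t this]
  show "w \<in> im E \<and> admissible_control U t u \<and> is_solution E A B t u x \<and>
    has_value_at t (\<lambda>s. E *v x s) 0 w \<and> has_value_at t (\<lambda>s. E *v x s) t w'"
    using * W by (auto simp: trajectory_def admissible_control_def is_solution_def intro!: exI[of _ ?g])
next
  assume *: "w \<in> im E \<and> admissible_control U t u \<and> is_solution E A B t u x \<and>
    has_value_at t (\<lambda>s. E *v x s) 0 w \<and> has_value_at t (\<lambda>s. E *v x s) t w'"
  then obtain g where g: "W11_with_derivative t (\<lambda>t. E *v x t) g"
    "AE s in lebesgue. s \<in> {0..t} \<longrightarrow> g s = A *v x s + B *v u s"
    by (auto simp: is_solution_def)
  let ?g = "\<lambda>r. A *v x r + B *v u r"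
  have same: "integral {0..s} g = integral {0..s} ?g" if "s \<in> {0..t}" for s
    using g(2) by (intro integral_AE_cong) (use that in \<open>auto elim: eventually_mono\<close>)
  have 0: "has_value_at t (\<lambda>s. E *v x s) 0 w" "has_value_at t (\<lambda>s. E *v x s) t w'"
    using * by auto
  show "trajectory E A B U t w w' u x"
    unfolding trajectory_def
  proof (intro conjI)
    show "AE s in lebesgue. s \<in> {0..t} \<longrightarrow> E *v x s = w + integral {0..s} ?g"
      using W11_values(1)[OF g(1) t 0] by eventually_elim (use same in auto)
    show "w' = w + integral {0..t} ?g"
      using W11_values(2)[OF g(1) t 0] same[of t] t by auto
  qed (use * t in \<open>auto simp: admissible_control_def is_solution_def\<close>)
qed

lemma trajectory_join:
  assumes 1: "trajectory E A B U s w w1 u x" and 2: "trajectory E A B U t w1 w2 u' x'"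
  shows "trajectory E A B U (s + t) w w2 (glue s u u') (glue s x x')"
proof -
  let ?g = "\<lambda>r. A *v x r + B *v u r" and ?g' = "\<lambda>r. A *v x' r + B *v u' r"
  have g: "?g absolutely_integrable_on {0..s}" "?g' absolutely_integrable_on {0..t}"
    using 1 2 by (auto intro!: absolutely_integrable_rhs simp: trajectory_def)
  have st: "0 \<le> s" "0 \<le> t" using 1 2 by (auto simp: trajectory_def)
  have w1: "w1 = w + integral {0..s} ?g" using 1 by (simp add: trajectory_def)
  show ?thesis
    unfolding trajectory_def glue_compose2[of "\<lambda>p q. A *v p + B *v q"]
  proof (intro conjI)
    show "AE \<sigma> in lebesgue. \<sigma> \<in> {0..s + t} \<longrightarrow> glue s u u' \<sigma> \<in> U"
      by (rule glue_AE) (use 1 2 in \<open>auto simp: trajectory_def\<close>)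
    show "AE \<sigma> in lebesgue. \<sigma> \<in> {0..s + t} \<longrightarrow>
        E *v glue s x x' \<sigma> = w + integral {0..\<sigma>} (glue s ?g ?g')"
    proof (rule glue_AE)
      have *: "integral {0..\<sigma>} (glue s ?g ?g') = integral {0..\<sigma>} ?g" if "\<sigma> \<le> s" for \<sigma>
        by (rule integral_cong) (use that in \<open>auto simp: glue_def\<close>)
      have "AE \<sigma> in lebesgue. \<sigma> \<in> {0..s} \<longrightarrow> E *v x \<sigma> = w + integral {0..\<sigma>} ?g"
        using 1 by (simp add: trajectory_def)
      then show "AE \<sigma> in lebesgue. \<sigma> \<in> {0..s} \<longrightarrow> E *v x \<sigma> = w + integral {0..\<sigma>} (glue s ?g ?g')"
        by eventually_elim (use * in auto)
      have *: "integral {0..s + \<sigma>} (glue s ?g ?g') = integral {0..s} ?g + integral {0..\<sigma>} ?g'"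
        if "\<sigma> \<in> {0..t}" for \<sigma>
      proof (rule glue_integral(2)[OF g(1) _ st(1)])
        show "?g' absolutely_integrable_on {0..\<sigma>}"
          by (rule absolutely_integrable_on_subinterval[OF g(2)]) (use that in auto)
      qed (use that in auto)
      have "AE \<sigma> in lebesgue. \<sigma> \<in> {0..t} \<longrightarrow> E *v x' \<sigma> = w1 + integral {0..\<sigma>} ?g'"
        using 2 by (simp add: trajectory_def)
      then show "AE \<sigma> in lebesgue. \<sigma> \<in> {0..t} \<longrightarrow> E *v x' \<sigma> = w + integral {0..s + \<sigma>} (glue s ?g ?g')"
        by eventually_elim (use * w1 in auto)
    qed
    show "w2 = w + integral {0..s + t} (glue s ?g ?g')"
      unfolding glue_integral(2)[OF g st] using 2 w1 by (simp add: trajectory_def)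
  qed (use 1 2 in \<open>auto simp: trajectory_def intro!: glue_integral(1)\<close>)
qed

text \<open>The weight \<open>a\<close> is an arbitrary real, so this covers convex combinations as
  well as reflections, where \<open>a\<close> is negative. Admissibility of the combined control is
  then not automatic and enters as a hypothesis.\<close>

lemma trajectory_affine_combination:
  assumes 1: "trajectory E A B U t v v' u x" and 2: "trajectory E A B U t w w' u' x'"
    and U: "AE s in lebesgue. s \<in> {0..t} \<longrightarrow> (1 - a) *\<^sub>R u s + a *\<^sub>R u' s \<in> U"
  shows "trajectory E A B U t ((1 - a) *\<^sub>R v + a *\<^sub>R w) ((1 - a) *\<^sub>R v' + a *\<^sub>R w')
    (\<lambda>s. (1 - a) *\<^sub>R u s + a *\<^sub>R u' s) (\<lambda>s. (1 - a) *\<^sub>R x s + a *\<^sub>R x' s)"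
proof -
  let ?g = "\<lambda>r. A *v x r + B *v u r" and ?g' = "\<lambda>r. A *v x' r + B *v u' r"
  have g: "?g absolutely_integrable_on {0..t}" "?g' absolutely_integrable_on {0..t}"
    using 1 2 by (auto intro!: absolutely_integrable_rhs simp: trajectory_def)
  have rhs: "(\<lambda>r. A *v ((1 - a) *\<^sub>R x r + a *\<^sub>R x' r) + B *v ((1 - a) *\<^sub>R u r + a *\<^sub>R u' r)) =
    (\<lambda>r. (1 - a) *\<^sub>R ?g r + a *\<^sub>R ?g' r)"
    by (simp add: matrix_vector_right_distrib matrix_vector_mult_scaleR scaleR_right_distrib add_ac)
  have int: "integral {0..s} (\<lambda>r. (1 - a) *\<^sub>R ?g r + a *\<^sub>R ?g' r) =
      (1 - a) *\<^sub>R integral {0..s} ?g + a *\<^sub>R integral {0..s} ?g'" if "s \<in> {0..t}" for s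
  proof -
    have gi: "?g integrable_on {0..s}" "?g' integrable_on {0..s}"
      using that by (auto intro!: set_lebesgue_integral_eq_integral(1)
        absolutely_integrable_on_subinterval[OF g(1)] absolutely_integrable_on_subinterval[OF g(2)])
    then show ?thesis
      by (simp only: Henstock_Kurzweil_Integration.integral_add integrable_cmul integral_cmul)
  qed
  have t: "0 \<le> t" using 1 by (simp add: trajectory_def)
  show ?thesis
    unfolding trajectory_def rhs
  proof (intro conjI U t)
    have "AE s in lebesgue. s \<in> {0..t} \<longrightarrow> E *v x s = v + integral {0..s} ?g"
      "AE s in lebesgue. s \<in> {0..t} \<longrightarrow> E *v x' s = w + integral {0..s} ?g'"
      using 1 2 by (simp_all add: trajectory_def)
    then show "AE s in lebesgue. s \<in> {0..t} \<longrightarrow> E *v ((1 - a) *\<^sub>R x s + a *\<^sub>R x' s) =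
        (1 - a) *\<^sub>R v + a *\<^sub>R w + integral {0..s} (\<lambda>r. (1 - a) *\<^sub>R ?g r + a *\<^sub>R ?g' r)"
    proof eventually_elim
      case (elim s)
      show ?case
      proof
        assume s: "s \<in> {0..t}"
        show "E *v ((1 - a) *\<^sub>R x s + a *\<^sub>R x' s) =
            (1 - a) *\<^sub>R v + a *\<^sub>R w + integral {0..s} (\<lambda>r. (1 - a) *\<^sub>R ?g r + a *\<^sub>R ?g' r)"
          unfolding int[OF s] using elim s
          by (simp add: matrix_vector_right_distrib matrix_vector_mult_scaleR scaleR_right_distrib)
      qed
    qed
    show "(1 - a) *\<^sub>R v' + a *\<^sub>R w' = (1 - a) *\<^sub>R v + a *\<^sub>R w +
        integral {0..t} (\<lambda>r. (1 - a) *\<^sub>R ?g r + a *\<^sub>R ?g' r)"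
      using int[of t] 1 2 t by (simp add: trajectory_def scaleR_right_distrib)
    show "(1 - a) *\<^sub>R v + a *\<^sub>R w \<in> im E"
      using 1 2 by (intro subspace_add subspace_scale subspace_im) (auto simp: trajectory_def)
  qed (use 1 2 in \<open>auto simp: trajectory_def intro!: set_integral_add absolutely_integrable_scaleR_left\<close>)
qed

text \<open>The lifted free motion solves the system with zero control, so superposing it changes
  the end points but not \<open>u\<close>; admissibility is kept for free.\<close>

lemma trajectory_add_flow:
  assumes 1: "trajectory E A B U t w w' u x"
    and X: "\<And>w. w \<in> im E \<Longrightarrow> E *v (X *v w) = w"
    and y: "\<And>s. (y has_vector_derivative A *v (X *v y s)) (at s)" and yE: "\<And>s. y s \<in> im E"
  shows "trajectory E A B U t (w + y 0) (w' + y t) u (\<lambda>s. x s + X *v y s)"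
proof -
  let ?g = "\<lambda>r. A *v x r + B *v u r"
  have g: "?g absolutely_integrable_on {0..t}"
    using 1 by (auto intro!: absolutely_integrable_rhs simp: trajectory_def)
  have t: "0 \<le> t" using 1 by (simp add: trajectory_def)
  have int: "integral {0..s} (\<lambda>r. A *v (x r + X *v y r) + B *v u r) = integral {0..s} ?g + (y s - y 0)"
    if "s \<in> {0..t}" for s
  proof -
    have gi: "?g integrable_on {0..s}"
      using that by (auto intro!: set_lebesgue_integral_eq_integral(1) absolutely_integrable_on_subinterval[OF g])
    have "((\<lambda>r. A *v (X *v y r)) has_integral y s - y 0) {0..s}"
      using that y by (intro fundamental_theorem_of_calculus) (auto intro: has_vector_derivative_at_within)
    from has_integral_add[OF integrable_integral[OF gi] this]
    show ?thesis
      by (intro integral_unique) (simp add: matrix_vector_right_distrib add_ac)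
  qed
  have "continuous_on {0..t} y"
    using y by (intro continuous_at_imp_continuous_on) (auto intro: has_vector_derivative_continuous)
  then have ya: "y absolutely_integrable_on {0..t}" by (rule absolutely_integrable_continuous_real)
  show ?thesis
    unfolding trajectory_def
  proof (intro conjI t)
    have "AE s in lebesgue. s \<in> {0..t} \<longrightarrow> E *v x s = w + integral {0..s} ?g"
      using 1 by (simp add: trajectory_def)
    then show "AE s in lebesgue. s \<in> {0..t} \<longrightarrow> E *v (x s + X *v y s) =
        w + y 0 + integral {0..s} (\<lambda>r. A *v (x r + X *v y r) + B *v u r)"
      by eventually_elim (use int in \<open>auto simp: matrix_vector_right_distrib X[OF yE]\<close>)
    show "w' + y t = w + y 0 + integral {0..t} (\<lambda>r. A *v (x r + X *v y r) + B *v u r)"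
      using int[of t] t 1 by (simp add: trajectory_def)
    show "w + y 0 \<in> im E"
      using 1 yE by (intro subspace_add subspace_im) (auto simp: trajectory_def)
    show "(\<lambda>s. x s + X *v y s) absolutely_integrable_on {0..t}"
      using 1 ya by (auto simp: trajectory_def intro!: set_integral_add absolutely_integrable_matrix_vector)
  qed (use 1 in \<open>auto simp: trajectory_def\<close>)
qed

lemma trajectory_steady_state:
  assumes "0 \<le> t" "A *v x + B *v u = 0" "u \<in> U"
  shows "trajectory E A B U t (E *v x) (E *v x) (\<lambda>s. u) (\<lambda>s. x)"
  using assms by (auto simp: trajectory_def im_def intro!: absolutely_integrable_continuous_real)

section \<open>Steering to an interior steady state\<close>

text \<open>Integrability is demanded explicitly: \<open>x\<close> is only integrable, and
  \<open>integral\<close> of a function that is not integrable is 0 by default, which would make the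
  bound meaningless.\<close>

definition steers ::
    "real^'n^'n \<Rightarrow> real^'n^'n \<Rightarrow> real^'m^'n \<Rightarrow> (real^'m) set \<Rightarrow> real^'n^'n \<Rightarrow>
     real \<Rightarrow> real \<Rightarrow> real^'n \<Rightarrow> real^'n \<Rightarrow> bool" where
  "steers E A B U P t c w w' \<longleftrightarrow> (\<exists>u x. trajectory E A B U t w w' u x \<and>
     (\<lambda>s. x s \<bullet> (P *v x s)) absolutely_integrable_on {0..t} \<and>
     integral {0..t} (\<lambda>s. x s \<bullet> (P *v x s)) \<le> c)"

lemma steers_join:
  assumes "steers E A B U P s c w w1" "steers E A B U P t d w1 w2"
  shows "steers E A B U P (s + t) (c + d) w w2"
proof -
  obtain u x where 1: "trajectory E A B U s w w1 u x"
     "(\<lambda>s. x s \<bullet> (P *v x s)) absolutely_integrable_on {0..s}"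
     "integral {0..s} (\<lambda>s. x s \<bullet> (P *v x s)) \<le> c"
    using assms(1) by (auto simp: steers_def)
  obtain u' x' where 2: "trajectory E A B U t w1 w2 u' x'"
     "(\<lambda>s. x' s \<bullet> (P *v x' s)) absolutely_integrable_on {0..t}"
     "integral {0..t} (\<lambda>s. x' s \<bullet> (P *v x' s)) \<le> d"
    using assms(2) by (auto simp: steers_def)
  have st: "0 \<le> s" "0 \<le> t" using 1 2 by (auto simp: trajectory_def)
  show ?thesis
    unfolding steers_def
    using trajectory_join[OF 1(1) 2(1)] glue_integral[OF 1(2) 2(2) st] 1(3) 2(3)
    by (intro exI[of _ "glue s u u'"] exI[of _ "glue s x x'"])
      (simp add: glue_compose[of "\<lambda>x. x \<bullet> (P *v x)"])
qed

text \<open>Integrability of \<open>x\<close> yields only measurability of the quadratic rate; the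
  integrable majorant \<open>g\<close> supplies the rest.\<close>

lemma quadratic_integrable_bound:
  fixes x :: "real \<Rightarrow> real^'n"
  assumes P: "symmetric_psd P" and x: "x absolutely_integrable_on {0..t}"
    and g: "g integrable_on {0..t}" and le: "\<And>s. s \<in> {0..t} \<Longrightarrow> x s \<bullet> (P *v x s) \<le> g s"
  shows "(\<lambda>s. x s \<bullet> (P *v x s)) absolutely_integrable_on {0..t}"
    "integral {0..t} (\<lambda>s. x s \<bullet> (P *v x s)) \<le> integral {0..t} g"
proof -
  have m: "x \<in> borel_measurable (lebesgue_on {0..t})"
    by (rule absolutely_integrable_imp_borel_measurable[OF x]) auto
  show *: "(\<lambda>s. x s \<bullet> (P *v x s)) absolutely_integrable_on {0..t}"
  proof (rule measurable_bounded_by_integrable_imp_absolutely_integrable[OF _ _ g])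
    have "continuous_on UNIV (\<lambda>x. x \<bullet> (P *v x))"
      by (intro continuous_intros linear_continuous_on) auto
    then show "(\<lambda>s. x s \<bullet> (P *v x s)) \<in> borel_measurable (lebesgue_on {0..t})"
      using measurable_compose[OF m borel_measurable_continuous_onI] by auto
  qed (use le P in \<open>auto simp: symmetric_psd_def\<close>)
  show "integral {0..t} (\<lambda>s. x s \<bullet> (P *v x s)) \<le> integral {0..t} g"
    by (rule integral_le[OF set_lebesgue_integral_eq_integral(1)[OF *] g le])
qed

text \<open>\<open>X\<close> picks a preimage under \<open>E\<close> along which the drift stays in \<open>im E\<close>, and \<open>x \<bullet> P x\<close> is the
  dissipation rate, which vanishes at the steady state.\<close>

locale steady_descriptor_system =
  fixes E A X P :: "real^'n^'n" and B :: "real^'m^'n" and U :: "(real^'m) set"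
    and xbar :: "real^'n" and ubar :: "real^'m"
  assumes EX: "\<And>w. w \<in> im E \<Longrightarrow> E *v (X *v w) = w"
    and AX: "\<And>w. w \<in> im E \<Longrightarrow> A *v (X *v w) \<in> im E"
    and P: "symmetric_psd P" and Pxbar: "P *v xbar = 0"
    and U: "convex U" "compact U" "ubar \<in> interior U"
    and steady: "A *v xbar + B *v ubar = 0"
begin

abbreviation wbar where "wbar \<equiv> E *v xbar"
abbreviation q where "q x \<equiv> x \<bullet> (P *v x)"
abbreviation steer where "steer \<equiv> steers E A B U P"

definition D :: "real \<Rightarrow> (real^'n) set" where
  "D r = {w. steer r r w wbar}"

definition S :: "(real^'n) set" where
  "S = (\<Union>r. D r)"

definition V :: "(real^'n) set" where
  "V = span ((\<lambda>w. w - wbar) ` S)"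

lemma ubar_in: "ubar \<in> U"
  using U(3) interior_subset by blast

lemma steer_stay: "0 \<le> t \<Longrightarrow> steer t 0 wbar wbar"
  unfolding steers_def using trajectory_steady_state[OF _ steady ubar_in] Pxbar by fastforce

text \<open>Waiting at \<open>wbar\<close> is free, so a shorter trajectory can be prolonged to last
  exactly \<open>r\<close>. This makes the sets \<open>D r\<close> monotone although their
  definition fixes the time.\<close>

lemma steer_imp_D:
  assumes "steer t c w wbar" "t \<le> r" "c \<le> r"
  shows "w \<in> D r"
proof -
  have "steer (t + (r - t)) (c + 0) w wbar"
    by (rule steers_join[OF assms(1) steer_stay]) (use assms in auto)
  then have "steer r c w wbar" by simp
  then show ?thesis using \<open>c \<le> r\<close> unfolding D_def steers_def by force
qed

lemma steer_imp_S: "steer t c w wbar \<Longrightarrow> w \<in> S"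
  unfolding S_def using steer_imp_D[of t c w "max t c"] by auto

lemma D_mono: "r \<le> s \<Longrightarrow> D r \<subseteq> D s"
  using steer_imp_D[of r r _ s] by (auto simp: D_def)

lemma D_pos: "w \<in> D r \<Longrightarrow> 0 \<le> r"
  by (auto simp: D_def steers_def trajectory_def)

lemma wbar_in_D: "0 \<le> r \<Longrightarrow> wbar \<in> D r"
  by (rule steer_imp_D[OF steer_stay]) auto

text \<open>All trajectories counted by \<open>D r\<close> have the same duration and can be
  combined pointwise in time; convexity of \<open>U\<close> admits the control and convexity of
  \<open>q\<close> keeps the budget.\<close>

lemma D_convex: "convex (D r)"
  unfolding convex_alt
proof (intro ballI allI impI)
  fix v w and a :: real
  assume vw: "v \<in> D r" "w \<in> D r" and a: "0 \<le> a \<and> a \<le> 1"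
  obtain u x where 1: "trajectory E A B U r v wbar u x"
    "(\<lambda>s. q (x s)) absolutely_integrable_on {0..r}" "integral {0..r} (\<lambda>s. q (x s)) \<le> r"
    using vw by (auto simp: D_def steers_def)
  obtain u' x' where 2: "trajectory E A B U r w wbar u' x'"
    "(\<lambda>s. q (x' s)) absolutely_integrable_on {0..r}" "integral {0..r} (\<lambda>s. q (x' s)) \<le> r"
    using vw by (auto simp: D_def steers_def)
  have "AE s in lebesgue. s \<in> {0..r} \<longrightarrow> u s \<in> U" "AE s in lebesgue. s \<in> {0..r} \<longrightarrow> u' s \<in> U"
    using 1 2 by (simp_all add: trajectory_def)
  then have "AE s in lebesgue. s \<in> {0..r} \<longrightarrow> (1 - a) *\<^sub>R u s + a *\<^sub>R u' s \<in> U"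
    by eventually_elim (use U(1) a in \<open>auto simp: convex_alt\<close>)
  from trajectory_affine_combination[OF 1(1) 2(1) this]
  have tr: "trajectory E A B U r ((1 - a) *\<^sub>R v + a *\<^sub>R w) wbar
    (\<lambda>s. (1 - a) *\<^sub>R u s + a *\<^sub>R u' s) (\<lambda>s. (1 - a) *\<^sub>R x s + a *\<^sub>R x' s)"
    by (simp flip: scaleR_add_left)
  have i: "(\<lambda>s. q (x s)) integrable_on {0..r}" "(\<lambda>s. q (x' s)) integrable_on {0..r}"
    using 1 2 set_lebesgue_integral_eq_integral(1) by auto
  have gi: "(\<lambda>s. (1 - a) * q (x s) + a * q (x' s)) integrable_on {0..r}"
    by (intro integrable_add integrable_on_mult_right i)
  have "integral {0..r} (\<lambda>s. (1 - a) * q (x s) + a * q (x' s)) =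
      (1 - a) * integral {0..r} (\<lambda>s. q (x s)) + a * integral {0..r} (\<lambda>s. q (x' s))"
    by (simp only: Henstock_Kurzweil_Integration.integral_add integrable_on_mult_right i
        Henstock_Kurzweil_Integration.integral_mult_right)
  also have "\<dots> \<le> (1 - a) * r + a * r"
    using a 1 2 by (intro add_mono mult_left_mono) auto
  finally have le: "integral {0..r} (\<lambda>s. (1 - a) * q (x s) + a * q (x' s)) \<le> r"
    by (simp add: algebra_simps)
  have xi: "(\<lambda>s. (1 - a) *\<^sub>R x s + a *\<^sub>R x' s) absolutely_integrable_on {0..r}"
    using tr by (simp add: trajectory_def)
  show "(1 - a) *\<^sub>R v + a *\<^sub>R w \<in> D r"
    using tr quadratic_integrable_bound[OF P xi gi symmetric_psd_convex[OF P]] a le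
    unfolding D_def steers_def by fastforce
qed

text \<open>Since \<open>ubar\<close> is interior, reflecting a trajectory through the steady state and shrinking it by
  a fixed factor keeps the control admissible.\<close>

lemma D_reflect: "\<exists>\<epsilon>>0. \<forall>r. \<forall>w\<in>D r. wbar - \<epsilon> *\<^sub>R (w - wbar) \<in> D r"
proof -
  obtain \<rho> where \<rho>: "\<rho> > 0" "cball ubar \<rho> \<subseteq> U"
    using U(3) mem_interior_cball by blast
  obtain M where M: "M > 0" "\<And>u. u \<in> U \<Longrightarrow> norm u \<le> M"
    using compact_imp_bounded[OF U(2)] bounded_pos by blast
  \<comment> \<open>No point of \<open>U\<close> is farther than \<open>2 * M\<close> from
    \<open>ubar\<close>, so the scaled reflection stays in the ball of radius \<rho>; the bound by 1
    prevents the dissipation from growing.\<close>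
  define \<epsilon> where "\<epsilon> = min 1 (\<rho> / (2 * M))"
  have \<epsilon>: "\<epsilon> > 0" "\<epsilon> \<le> 1" "\<epsilon> * (2 * M) \<le> \<rho>"
    using \<rho> M by (auto simp: \<epsilon>_def min_def field_simps)
  have uU: "(1 - (- \<epsilon>)) *\<^sub>R ubar + (- \<epsilon>) *\<^sub>R u \<in> U" if "u \<in> U" for u
  proof -
    have "norm (u - ubar) \<le> 2 * M"
      using norm_triangle_ineq4[of u ubar] M(2)[OF that] M(2)[OF ubar_in] by simp
    then have "norm (\<epsilon> *\<^sub>R (u - ubar)) \<le> \<epsilon> * (2 * M)"
      using \<epsilon>(1) by simp
    then have "norm (\<epsilon> *\<^sub>R (u - ubar)) \<le> \<rho>" using \<epsilon>(3) by simp
    then have "ubar - \<epsilon> *\<^sub>R (u - ubar) \<in> U"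
      using \<rho>(2) by (intro subsetD[OF \<rho>(2)]) (simp add: dist_norm)
    then show ?thesis by (simp add: algebra_simps)
  qed
  have "wbar - \<epsilon> *\<^sub>R (w - wbar) \<in> D r" if w: "w \<in> D r" for r w
  proof -
    obtain u x where 1: "trajectory E A B U r w wbar u x"
      "(\<lambda>s. q (x s)) absolutely_integrable_on {0..r}" "integral {0..r} (\<lambda>s. q (x s)) \<le> r"
      using w by (auto simp: D_def steers_def)
    have "AE s in lebesgue. s \<in> {0..r} \<longrightarrow> u s \<in> U"
      using 1 by (simp add: trajectory_def)
    then have "AE s in lebesgue. s \<in> {0..r} \<longrightarrow> (1 - (- \<epsilon>)) *\<^sub>R ubar + (- \<epsilon>) *\<^sub>R u s \<in> U"
      by eventually_elim (use uU in auto)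
    note tr0 = trajectory_affine_combination[OF trajectory_steady_state[OF D_pos[OF w] steady ubar_in] 1(1) this]
    let ?x = "\<lambda>s. (1 - (- \<epsilon>)) *\<^sub>R xbar + (- \<epsilon>) *\<^sub>R x s"
    have tr: "trajectory E A B U r (wbar - \<epsilon> *\<^sub>R (w - wbar)) wbar
        (\<lambda>s. (1 - (- \<epsilon>)) *\<^sub>R ubar + (- \<epsilon>) *\<^sub>R u s) ?x"
      using tr0 by (simp add: algebra_simps)
    have qx: "q (?x s) \<le> q (x s)" for s
    proof -
      \<comment> \<open>\<open>P *v xbar = 0\<close> removes the cross terms as well as the square
        of the steady part.\<close>
      have "q (?x s) = \<epsilon>\<^sup>2 * q (x s)"
        using symmetric_psd_inner_commute[OF P, of xbar] Pxbar
        by (simp add: matrix_vector_right_distrib matrix_vector_mult_diff_distrib matrix_vector_mult_scaleR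
            inner_add_left inner_diff_left power2_eq_square)
      also have "\<dots> \<le> q (x s)"
        using \<epsilon> P by (intro mult_left_le_one_le power_le_one) (auto simp: symmetric_psd_def)
      finally show ?thesis .
    qed
    have xi: "?x absolutely_integrable_on {0..r}"
      using tr by (simp add: trajectory_def)
    show ?thesis
      using tr quadratic_integrable_bound[OF P xi set_lebesgue_integral_eq_integral(1)[OF 1(2)] qx] 1(3)
      unfolding D_def steers_def by fastforce
  qed
  then show ?thesis using \<epsilon>(1) by blast
qed

text \<open>The factors two come from \<open>symmetric_psd_add_bound\<close>: no sign of the mixed
  term is known when the free motion is superposed.\<close>

lemma steer_add_flow:
  assumes w: "steer t c w w'"
    and y: "\<And>s. (y has_vector_derivative A *v (X *v y s)) (at s)" and yE: "\<And>s. y s \<in> im E"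
    and b: "\<And>s. s \<in> {0..t} \<Longrightarrow> q (X *v y s) \<le> b"
  shows "steer t (2 * c + 2 * b * t) (w + y 0) (w' + y t)"
proof -
  obtain u x where 1: "trajectory E A B U t w w' u x"
    "(\<lambda>s. q (x s)) absolutely_integrable_on {0..t}" "integral {0..t} (\<lambda>s. q (x s)) \<le> c"
    using w by (auto simp: steers_def)
  have tr: "trajectory E A B U t (w + y 0) (w' + y t) u (\<lambda>s. x s + X *v y s)"
    by (rule trajectory_add_flow[OF 1(1) EX y yE])
  then have t: "0 \<le> t" and xi: "(\<lambda>s. x s + X *v y s) absolutely_integrable_on {0..t}"
    by (auto simp: trajectory_def)
  have i: "(\<lambda>s. q (x s)) integrable_on {0..t}" 
    using 1 set_lebesgue_integral_eq_integral(1) by auto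
  have gi: "(\<lambda>s. 2 * q (x s) + 2 * b) integrable_on {0..t}"
    by (intro integrable_add integrable_on_mult_right i integrable_const_ivl)
  have le: "q (x s + X *v y s) \<le> 2 * q (x s) + 2 * b" if "s \<in> {0..t}" for s
    using symmetric_psd_add_bound[OF P, of "x s" "X *v y s"] b[OF that] by simp
  have "integral {0..t} (\<lambda>s. 2 * q (x s) + 2 * b) = 2 * integral {0..t} (\<lambda>s. q (x s)) + 2 * b * t"
    using t by (simp add: Henstock_Kurzweil_Integration.integral_add integrable_on_mult_right i
        integrable_const_ivl)
  also have "\<dots> \<le> 2 * c + 2 * b * t" using 1(3) by simp
  finally show ?thesis
    using tr quadratic_integrable_bound[OF P xi gi le] unfolding steers_def by fastforce
qed

lemma lift_q_bounded:
  fixes y :: "'a::topological_space \<Rightarrow> real^'n"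
  assumes y: "continuous_on K y" and "compact K"
  obtains b where "\<And>s. s \<in> K \<Longrightarrow> q (X *v y s) \<le> b"
proof -
  have 1: "continuous_on K (\<lambda>s. X *v y s)"
    by (rule continuous_on_compose2[OF matrix_vector_mult_linear_continuous_on[of UNIV] y]) auto
  have "continuous_on K (\<lambda>s. P *v (X *v y s))"
    by (rule continuous_on_compose2[OF matrix_vector_mult_linear_continuous_on[of UNIV] 1]) auto
  with 1 have "continuous_on K (\<lambda>s. q (X *v y s))"
    by (rule continuous_on_inner)
  then have "bounded ((\<lambda>s. q (X *v y s)) ` K)"
    using \<open>compact K\<close> by (intro compact_imp_bounded compact_continuous_image)
  then obtain b where "\<forall>z\<in>(\<lambda>s. q (X *v y s)) ` K. \<bar>z\<bar> \<le> b"
    unfolding bounded_real by blast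
  then show thesis
    by (intro that[of b]) (auto dest: bspec intro: abs_le_D1)
qed

section \<open>The span of the deviations and its invariance\<close>

lemma S_subset: "w \<in> S \<Longrightarrow> w \<in> im E"
  by (auto simp: S_def D_def steers_def trajectory_def)

lemma wbar_in_im: "wbar \<in> im E"
  by (simp add: im_def)

lemma V_subset: "V \<subseteq> im E"
  unfolding V_def using S_subset
  by (intro span_minimal subspace_im) (auto intro!: subspace_diff subspace_im wbar_in_im)

text \<open>The exponential flow of \<open>A X\<close>, which preserves \<open>im E\<close> by the
  choice of the lift. Invariance is kept for arbitrary \<open>W\<close> because the flow is needed
  to prove \<open>V\<close> invariant before \<open>V\<close> can be inserted.\<close>

lemma deviation_flow:
  obtains Y K where
    "\<And>t v. ((\<lambda>s. Y s v) has_vector_derivative A *v (X *v Y t v)) (at t)"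
    "\<And>v. Y 0 v = v" "\<And>s v. v \<in> im E \<Longrightarrow> Y s v \<in> im E"
    "\<And>s v W. subspace W \<Longrightarrow> (\<lambda>v. A *v (X *v v)) ` W \<subseteq> W \<Longrightarrow> v \<in> W \<Longrightarrow> Y s v \<in> W"
    "\<And>s v. norm (Y s v) \<le> exp (K * \<bar>s\<bar>) * norm v" "0 \<le> K"
proof -
  have lin: "linear (\<lambda>v. A *v (X *v v))"
    using linear_compose[of "(*v) X" "(*v) A"] by (simp add: o_def)
  obtain Y K where Y:
    "\<And>t v. ((\<lambda>s. Y s v) has_vector_derivative A *v (X *v Y t v)) (at t)"
    "\<And>v. Y 0 v = v"
    "\<And>W s v. subspace W \<Longrightarrow> (\<lambda>v. A *v (X *v v)) ` W \<subseteq> W \<Longrightarrow> v \<in> W \<Longrightarrow> Y s v \<in> W"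
    "\<And>s v. norm (Y s v) \<le> exp (K * \<bar>s\<bar>) * norm v" "0 \<le> K"
    by (rule linear_flow[OF lin]) (rule that; assumption)
  have "Y s v \<in> im E" if "v \<in> im E" for s v
    by (rule Y(3)[OF subspace_im]) (use AX that in auto)
  then show thesis
    by (rule that[OF Y(1,2) _ Y(3-5)])
qed

text \<open>Starting further back along the uncontrolled deviation flow from a point of \<open>S\<close> still reaches
  \<open>wbar\<close>; differentiating this at time zero shows that \<open>V\<close> is invariant.\<close>

lemma V_invariant: "(\<lambda>v. A *v (X *v v)) ` V \<subseteq> V"
proof -
  obtain Y K where Y: 
    "\<And>t v. ((\<lambda>s. Y s v) has_vector_derivative A *v (X *v Y t v)) (at t)"
    "\<And>v. Y 0 v = v" "\<And>s v. v \<in> im E \<Longrightarrow> Y s v \<in> im E"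
    "\<And>s v W. subspace W \<Longrightarrow> (\<lambda>v. A *v (X *v v)) ` W \<subseteq> W \<Longrightarrow> v \<in> W \<Longrightarrow> Y s v \<in> W"
    "\<And>s v. norm (Y s v) \<le> exp (K * \<bar>s\<bar>) * norm v" "0 \<le> K"
    by (rule deviation_flow) (rule that; assumption)
  have sV: "subspace V" by (simp add: V_def)
  have *: "A *v (X *v (w - wbar)) \<in> V" if w: "w \<in> S" for w
  proof -
    define d where "d = w - wbar"
    have dE: "d \<in> im E"
      unfolding d_def using S_subset[OF w] by (intro subspace_diff subspace_im wbar_in_im)
    have dV: "d \<in> V" unfolding V_def d_def using w by (intro span_base) auto
    obtain r where r: "steer r r w wbar" using w by (auto simp: S_def D_def)
    \<comment> \<open>The free motion started at \<open>Y (- s) d\<close> and added to the steady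
      state arrives at \<open>wbar + d = w\<close> after time \<open>s\<close>; from there
      \<open>wbar\<close> is reached, so the starting point is in \<open>S\<close>.\<close>
    have backward: "Y (- s) d \<in> V" if s: "0 \<le> s" for s
    proof -
      define y where "y = (\<lambda>\<sigma>. Y (\<sigma> - s) d)"
      have y: "(y has_vector_derivative A *v (X *v y \<sigma>)) (at \<sigma>)" for \<sigma>
      proof -
        have "((\<lambda>\<sigma>. \<sigma> - s) has_vector_derivative 1) (at \<sigma>)"
          by (auto intro!: derivative_eq_intros)
        from vector_diff_chain_at[OF this, of "\<lambda>s. Y s d"] Y(1)
        show ?thesis by (auto simp: o_def y_def)
      qed
      have yE: "y \<sigma> \<in> im E" for \<sigma> using Y(3)[OF dE] by (simp add: y_def)
      have "continuous_on {0..s} y"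
        using y by (intro continuous_at_imp_continuous_on) (auto intro: has_vector_derivative_continuous)
      then obtain b where b: "\<And>\<sigma>. \<sigma> \<in> {0..s} \<Longrightarrow> q (X *v y \<sigma>) \<le> b"
        using lift_q_bounded[OF _ compact_Icc] by blast
      have "steer s (2 * 0 + 2 * b * s) (wbar + y 0) (wbar + y s)"
        by (rule steer_add_flow[OF steer_stay[OF s] y yE b])
      then have "steer s (2 * 0 + 2 * b * s) (wbar + Y (- s) d) w"
        using Y(2) by (simp add: y_def d_def)
      from steer_imp_S[OF steers_join[OF this r]] have "wbar + Y (- s) d \<in> S" .
      then have "(wbar + Y (- s) d) - wbar \<in> V"
        unfolding V_def by (intro span_base) blast
      then show ?thesis by simp
    qed
    have "((\<lambda>h. (1 / h) *\<^sub>R (Y h d - d)) \<longlongrightarrow> A *v (X *v d)) (at 0)"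
    proof -
      have "((\<lambda>s. Y s d) has_vector_derivative A *v (X *v d)) (at 0)"
        using Y(1)[of d 0] Y(2) by simp
      then have "((\<lambda>h. norm (Y h d - d - h *\<^sub>R (A *v (X *v d))) / norm h) \<longlongrightarrow> 0) (at 0)"
        using Y(2) by (simp add: has_vector_derivative_def has_derivative_at)
      then have "((\<lambda>h. norm ((1 / h) *\<^sub>R (Y h d - d) - A *v (X *v d))) \<longlongrightarrow> 0) (at 0)"
      proof (rule Lim_transform_eventually)
        show "\<forall>\<^sub>F h in at 0. norm (Y h d - d - h *\<^sub>R (A *v (X *v d))) / norm h =
          norm ((1 / h) *\<^sub>R (Y h d - d) - A *v (X *v d))"
          unfolding eventually_at_filter
        proof (rule always_eventually, intro allI impI)
          fix h :: real assume h: "h \<noteq> 0"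
          have "(1 / h) *\<^sub>R (Y h d - d) - A *v (X *v d) = (1 / h) *\<^sub>R (Y h d - d - h *\<^sub>R (A *v (X *v d)))"
            using h by (simp add: scaleR_diff_right)
          then show "norm (Y h d - d - h *\<^sub>R (A *v (X *v d))) / norm h =
              norm ((1 / h) *\<^sub>R (Y h d - d) - A *v (X *v d))"
            by simp
        qed
      qed
      then show ?thesis by (simp add: tendsto_norm_zero_iff LIM_zero_iff)
    qed
    \<comment> \<open>Only backward times are known to stay in \<open>V\<close>, hence the limit
      from the left.\<close>
    then have lim: "((\<lambda>h. (1 / h) *\<^sub>R (Y h d - d)) \<longlongrightarrow> A *v (X *v d)) (at_left 0)"
      by (rule tendsto_mono[OF at_le, rotated]) simp
    have "A *v (X *v d) \<in> V"
    proof (rule Lim_in_closed_set[OF closed_subspace[OF sV] _ _ lim])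
      show "\<forall>\<^sub>F h in at_left 0. (1 / h) *\<^sub>R (Y h d - d) \<in> V"
        unfolding eventually_at_filter
      proof (rule always_eventually, intro allI impI)
        fix h :: real assume "h \<in> {..<0}"
        then have "Y h d \<in> V" using backward[of "- h"] by simp
        then show "(1 / h) *\<^sub>R (Y h d - d) \<in> V"
          by (intro subspace_scale subspace_diff sV dV)
      qed
    qed simp
    then show ?thesis by (simp add: d_def)
  qed
  have "V \<subseteq> {v. A *v (X *v v) \<in> V}"
    unfolding V_def
  proof (rule span_minimal)
    show "(\<lambda>w. w - wbar) ` S \<subseteq> {v. A *v (X *v v) \<in> span ((\<lambda>w. w - wbar) ` S)}"
      using * by (auto simp: V_def)
    show "subspace {v. A *v (X *v v) \<in> span ((\<lambda>w. w - wbar) ` S)}"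
      by (auto simp: subspace_def matrix_vector_right_distrib matrix_vector_mult_scaleR
          intro: span_add span_scale span_zero)
  qed
  then show ?thesis by blast
qed

section \<open>Local boundedness of steering\<close>

text \<open>\<open>S\<close> is a union over infinitely many budgets, but a basis of
  \<open>V\<close> chosen among the deviations is finite, so a single \<open>D r0\<close> contains
  all of the corresponding points. Shifted to the origin it is a convex set \<open>C\<close> that
  contains 0, so its affine hull is its span and includes \<open>V\<close>.\<close>

lemma steady_state_neighbourhood:
  "\<exists>r0 \<rho>. \<rho> > 0 \<and> (\<forall>v\<in>V. norm v < \<rho> \<longrightarrow> wbar + v \<in> D r0)"
proof -
  obtain b where b: "b \<subseteq> (\<lambda>w. w - wbar) ` S" "independent b" "(\<lambda>w. w - wbar) ` S \<subseteq> span b"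
    using maximal_independent_subset by metis
  have fin: "finite b" using b(2) independent_imp_finite by blast
  have "\<forall>v\<in>b. \<exists>r. wbar + v \<in> D r" 
  proof
    fix v assume "v \<in> b"
    then obtain w where "w \<in> S" "v = w - wbar" using b(1) by blast
    then show "\<exists>r. wbar + v \<in> D r" by (auto simp: S_def)
  qed
  then obtain r where r: "\<And>v. v \<in> b \<Longrightarrow> wbar + v \<in> D (r v)" by metis
  define r0 where "r0 = Max (insert 0 (r ` b))"
  have r0: "0 \<le> r0" "\<And>v. v \<in> b \<Longrightarrow> r v \<le> r0"
    using fin by (auto simp: r0_def)
  define C where "C = (\<lambda>w. - wbar + w) ` D r0"
  have C: "convex C" "0 \<in> C"
    using convex_translation[OF D_convex] wbar_in_D[OF r0(1)] by (auto simp: C_def image_iff)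
  have bC: "b \<subseteq> C"
  proof
    fix v assume v: "v \<in> b"
    have "wbar + v \<in> D r0" using r[OF v] D_mono[OF r0(2)[OF v]] by blast
    then show "v \<in> C" by (force simp: C_def)
  qed
  have "V \<subseteq> span C"
    unfolding V_def using b(3) span_mono[OF bC] by (intro span_minimal) auto
  then have aff: "V \<subseteq> affine hull C"
    using affine_hull_span_0 hull_inc[OF C(2)] by metis
  obtain \<epsilon> where \<epsilon>: "\<epsilon> > 0" "\<And>r w. w \<in> D r \<Longrightarrow> wbar - \<epsilon> *\<^sub>R (w - wbar) \<in> D r"
    using D_reflect by blast
  \<comment> \<open>Relative interior points are those through which every segment from a point of
    the convex set can be prolonged within it; the reflection prolongs by the factor
    \<open>1 + \<epsilon>\<close>.\<close>
  have "0 \<in> rel_interior C"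
    unfolding convex_rel_interior_iff[OF C(1) ex_in_conv[THEN iffD1, OF exI, OF C(2)]]
  proof (intro ballI exI conjI)
    fix x assume "x \<in> C"
    then have "wbar - \<epsilon> *\<^sub>R x \<in> D r0"
      using \<epsilon>(2)[of "wbar + x" r0] by (auto simp: C_def)
    then have "- \<epsilon> *\<^sub>R x \<in> C" by (force simp: C_def)
    then show "(1 - (1 + \<epsilon>)) *\<^sub>R x + (1 + \<epsilon>) *\<^sub>R 0 \<in> C" by simp
    show "1 + \<epsilon> > 1" using \<epsilon>(1) by simp
  qed
  then obtain \<rho> where \<rho>: "\<rho> > 0" "ball 0 \<rho> \<inter> affine hull C \<subseteq> C"
    using mem_rel_interior_ball by blast
  have "wbar + v \<in> D r0" if "v \<in> V" "norm v < \<rho>" for v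
  proof -
    have "v \<in> C" using \<rho>(2) aff that by auto
    then show ?thesis by (auto simp: C_def)
  qed
  then show ?thesis using \<rho>(1) by blast
qed

lemma locally_bounded_steering:
  assumes w: "w \<in> S"
  shows "\<exists>e>0. \<exists>r. ball w e \<inter> S \<subseteq> D r"
proof -
  obtain r where r: "steer r r w wbar" using w by (auto simp: S_def D_def)
  then have r_pos: "0 \<le> r" by (auto simp: steers_def trajectory_def)
  obtain r0 \<rho> where \<rho>: "\<rho> > 0" "\<And>v. v \<in> V \<Longrightarrow> norm v < \<rho> \<Longrightarrow> wbar + v \<in> D r0"
    using steady_state_neighbourhood by blast
  obtain Y K where Y: 
    "\<And>t v. ((\<lambda>s. Y s v) has_vector_derivative A *v (X *v Y t v)) (at t)"
    "\<And>v. Y 0 v = v" "\<And>s v. v \<in> im E \<Longrightarrow> Y s v \<in> im E"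
    "\<And>s v W. subspace W \<Longrightarrow> (\<lambda>v. A *v (X *v v)) ` W \<subseteq> W \<Longrightarrow> v \<in> W \<Longrightarrow> Y s v \<in> W"
    "\<And>s v. norm (Y s v) \<le> exp (K * \<bar>s\<bar>) * norm v" "0 \<le> K"
    by (rule deviation_flow) (rule that; assumption)
  have sV: "subspace V" by (simp add: V_def)
  \<comment> \<open>Dividing by the growth over time \<open>r\<close> keeps the perturbation below
    \<rho>, so that it ends in the neighbourhood of \<open>wbar\<close>, and below 1, so that one
    bound for \<open>q\<close> on the lifted unit ball serves all perturbations.\<close>
  define e where "e = min 1 \<rho> / exp (K * r)"
  have e: "e > 0" using \<rho>(1) by (simp add: e_def)
  have Yle: "norm (Y s v) < min 1 \<rho>" if "norm v < e" "s \<in> {0..r}" for s v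
  proof -
    have "norm (Y s v) \<le> exp (K * s) * norm v" using Y(5)[of s v] that by simp
    also have "\<dots> \<le> exp (K * r) * norm v" using that Y(6) by (intro mult_right_mono) (auto intro: mult_left_mono)
    also have "\<dots> < exp (K * r) * e" using that(1) by simp
    finally show ?thesis by (simp add: e_def)
  qed
  obtain b where b: "\<And>z. z \<in> cball 0 1 \<Longrightarrow> q (X *v z) \<le> b"
    using lift_q_bounded[OF continuous_on_id compact_cball, of 0 1] by blast
  \<comment> \<open>The larger of total time and total dissipation of the perturbed trajectory
    followed by one steering to \<open>wbar\<close> within \<open>D r0\<close>.\<close>
  define R where "R = max (r + r0) (2 * r + 2 * b * r + r0)"
  have "w' \<in> D R" if w': "w' \<in> ball w e" "w' \<in> S" for w'
  proof -
    define v where "v = w' - w"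
    have "(w' - wbar) - (w - wbar) \<in> V"
      unfolding V_def using w w' by (intro span_diff span_base) auto
    then have vV: "v \<in> V" by (simp add: v_def)
    have vE: "v \<in> im E" using vV V_subset by blast
    have ve: "norm v < e" using w' by (simp add: v_def dist_norm norm_minus_commute)
    have "q (X *v Y s v) \<le> b" if "s \<in> {0..r}" for s
      using b Yle[OF ve that] by simp
    from steer_add_flow[OF r Y(1) Y(3)[OF vE] this]
    have "steer r (2 * r + 2 * b * r) w' (wbar + Y r v)"
      by (simp add: Y(2) v_def)
    moreover have "wbar + Y r v \<in> D r0"
      using Yle[OF ve, of r] r_pos by (intro \<rho>(2) Y(4) sV V_invariant vV) auto
    ultimately have "steer (r + r0) (2 * r + 2 * b * r + r0) w' wbar"
      unfolding D_def by (blast intro: steers_join)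
    then show ?thesis by (rule steer_imp_D) (auto simp: R_def)
  qed
  then show ?thesis using e by blast
qed

lemma continuous_steering_bound:
  obtains g :: "real^'n \<Rightarrow> real" where "continuous_on S g" "\<And>w. w \<in> S \<Longrightarrow> 0 \<le> g w"
    "\<And>w. w \<in> S \<Longrightarrow> steer (g w) (g w) w wbar"
proof -
  obtain g where g: "continuous_on S g" "\<And>w. w \<in> S \<Longrightarrow> 0 \<le> g w" "\<And>w. w \<in> S \<Longrightarrow> w \<in> D (g w)"
    by (rule continuous_majorant[OF D_mono locally_bounded_steering]) (assumption | rule that; assumption)+
  show thesis
    by (rule that[OF g(1,2)]) (use g(3) in \<open>auto simp: D_def\<close>)
qed

end

section \<open>Energy balance and the turnpike\<close>

text \<open>Inside the interval the points where \<open>f\<close> differs from \<open>c\<close> form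
  an open null set, which is empty; continuity settles the end points.\<close>

lemma continuous_AE_constant:
  fixes f :: "real \<Rightarrow> 'a::euclidean_space"
  assumes f: "continuous_on {a..b} f" and ae: "AE t in lebesgue. t \<in> {a..b} \<longrightarrow> f t = c"
    and "a < b" "t \<in> {a..b}"
  shows "f t = c"
proof (rule continuous_constant_on_closure[of "{a<..<b}" f])
  show "continuous_on (closure {a<..<b}) f" "t \<in> closure {a<..<b}"
    using assms by auto
  obtain N where N: "negligible N" "\<And>t. t \<notin> N \<Longrightarrow> t \<in> {a..b} \<longrightarrow> f t = c"
    using ae unfolding eventually_ae_filter_negligible by blast
  let ?W = "{a<..<b} \<inter> f -` (- {c})"
  have "open ?W"
    by (rule continuous_open_preimage) (auto intro: continuous_on_subset[OF f])
  moreover have "?W \<subseteq> N" using N(2) by force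
  then have "negligible ?W" by (rule negligible_subset[OF N(1)])
  ultimately have "?W = {}"
    using open_not_negligible by blast
  then show "f s = c" if "s \<in> {a<..<b}" for s
    using that by blast
qed

lemma absolutely_integrable_on_singleton [simp]:
  fixes f :: "real \<Rightarrow> 'a::euclidean_space"
  shows "f absolutely_integrable_on {a}"
  using absolutely_integrable_on_null[of a a f] by simp

text \<open>The constraint by \<open>U\<close> is vacuous on a time interval that is a null set, so
  any control value will do.\<close>

lemma trajectory_trivial:
  assumes "w \<in> im E"
  shows "\<exists>u x. trajectory E A B U 0 w w u x"
proof -
  obtain x where x: "w = E *v x" using assms by (auto simp: im_def)
  have "AE s in lebesgue. s \<in> {0..0::real} \<longrightarrow> (0 :: real^'b) \<in> U"
    unfolding eventually_ae_filter_negligible by (intro exI[of _ "{0}"]) auto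
  then have "trajectory E A B U 0 w w (\<lambda>s. 0) (\<lambda>s. x)"
    using assms x by (auto simp: trajectory_def)
  then show ?thesis by blast
qed

lemma reach_set_at_iff_trajectory:
  assumes "0 \<le> t" "w' \<in> im E"
  shows "w \<in> reach_set_at E A B U t w' \<longleftrightarrow> (\<exists>u x. trajectory E A B U t w w' u x)"
proof (cases "t = 0")
  case True
  have "w = w'" if "trajectory E A B U 0 w w' u x" for u x
    using that by (simp add: trajectory_def)
  then show ?thesis
    using True trajectory_trivial[OF assms(2)] by (auto simp: reach_set_at_def)
next
  case False
  then show ?thesis
    using assms by (auto simp: reach_set_at_def trajectory_iff_solution)
qed

section \<open>Power balance and stored energy\<close>

locale port_hamiltonian =
  fixes J R Q E X :: "real^'n^'n" and B :: "real^'m^'n" and U :: "(real^'m) set"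
  assumes J: "J = - transpose J" and R: "symmetric_psd R" and QE: "symmetric_psd (transpose Q ** E)"
    and lift: "\<And>w. w \<in> im E \<Longrightarrow> E *v (X *v w) = w"
    and U_bounded: "bounded U"
begin

abbreviation A where "A \<equiv> (J - R) ** Q"
abbreviation P where "P \<equiv> transpose Q ** R ** Q"
abbreviation q where "q x \<equiv> x \<bullet> (P *v x)"
text \<open>The Hamiltonian, half of \<open>(Q *v x) \<bullet> (E *v x)\<close>, as a function of
  \<open>w = E *v x\<close> alone: the representative of \<open>E x\<close> has values at the end
  points, \<open>x\<close> has none.\<close>

definition H :: "real^'n \<Rightarrow> real" where "H w = ((Q ** X) *v w) \<bullet> w / 2"

lemma inner_transpose: "x \<bullet> (transpose M *v y) = (M *v x) \<bullet> (y :: real^'n)"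
  for M :: "real^'k^'n"
  by (metis dot_lmul_matrix inner_commute transpose_matrix_vector)

lemma q_eq: "q x = (Q *v x) \<bullet> (R *v (Q *v x))"
  by (simp add: inner_transpose del: transpose_matrix_vector flip: matrix_vector_mul_assoc)

lemma P_psd: "symmetric_psd P"
  using R unfolding symmetric_psd_def q_eq
  by (simp add: matrix_transpose_mul matrix_mul_assoc)

lemma J_skew: "x \<bullet> (J *v x) = 0"
proof -
  have "x \<bullet> (J *v x) = - (x \<bullet> (transpose J *v x))"
  proof -
    have "(J + transpose J) *v x = 0"
      using J by (metis add.left_inverse matrix_vector_mult_0)
    then show ?thesis
      by (simp add: matrix_vector_mult_add_rdistrib add_eq_0_iff2 del: transpose_matrix_vector)
  qed
  then show ?thesis by (simp add: inner_transpose inner_commute del: transpose_matrix_vector)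
qed

text \<open>Skew symmetry cancels \<open>J\<close>, the part with \<open>R\<close> is the
  dissipation, and the input term pairs with the output because \<open>y = B^T Q x\<close>.\<close>

lemma supply_rate: "(Q *v x) \<bullet> (A *v x + B *v u) = u \<bullet> sys_output Q B x - q x"
proof -
  have "(Q *v x) \<bullet> (B *v u) = u \<bullet> sys_output Q B x"
    using inner_transpose[of u B "Q *v x"]
    by (simp add: sys_output_def inner_commute flip: matrix_vector_mul_assoc)
  then show ?thesis
    unfolding q_eq
    by (simp add: J_skew inner_add_right inner_diff_right matrix_vector_mult_diff_rdistrib
        del: transpose_matrix_vector flip: matrix_vector_mul_assoc)
qed

lemma inner_Q_E_commute: "(Q *v a) \<bullet> (E *v b) = (Q *v b) \<bullet> (E *v a)"
proof -
  have "(Q *v a) \<bullet> (E *v b) = a \<bullet> ((transpose Q ** E) *v b)" for a b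
    by (simp add: inner_transpose del: transpose_matrix_vector flip: matrix_vector_mul_assoc)
  then show ?thesis
    using symmetric_psd_inner_commute[OF QE, of a b] by (simp add: inner_commute)
qed

lemma inner_QX_commute:
  assumes "v \<in> im E" "w \<in> im E"
  shows "((Q ** X) *v v) \<bullet> w = ((Q ** X) *v w) \<bullet> v"
  using inner_Q_E_commute[of "X *v v" "X *v w"] assms
  by (simp add: lift flip: matrix_vector_mul_assoc)

lemma H_nonneg:
  assumes "w \<in> im E"
  shows "0 \<le> H w"
proof -
  have "((Q ** X) *v w) \<bullet> w = (Q *v (X *v w)) \<bullet> (E *v (X *v w))"
    using assms by (simp add: lift flip: matrix_vector_mul_assoc)
  also have "\<dots> = (X *v w) \<bullet> ((transpose Q ** E) *v (X *v w))"
    by (simp add: inner_transpose del: transpose_matrix_vector flip: matrix_vector_mul_assoc)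
  finally show ?thesis using QE by (simp add: H_def symmetric_psd_def)
qed

text \<open>The component of the state in the kernel of \<open>E\<close> does not contribute to the power.\<close>

lemma power_eq:
  assumes "g \<in> im E"
  shows "(Q *v x) \<bullet> g = ((Q ** X) *v (E *v x)) \<bullet> g"
proof -
  obtain h where h: "g = E *v h" using assms by (auto simp: im_def)
  have "E *v x \<in> im E" by (simp add: im_def)
  then have "E *v (X *v (E *v x)) = E *v x" by (rule lift)
  then show ?thesis
    using inner_Q_E_commute[of x h] inner_Q_E_commute[of "X *v (E *v x)" h]
    by (simp add: h flip: matrix_vector_mul_assoc)
qed

text \<open>\<open>im E\<close> is the kernel of \<open>mat 1 - E ** X\<close>. The integral curve
  lies in it almost everywhere, hence everywhere by continuity; the projected right-hand side then
  has vanishing indefinite integral and is zero almost everywhere. \<open>power_eq\<close> needs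
  this membership.\<close>

lemma trajectory_rhs_in_im:
  assumes tr: "trajectory E A B U t w w' u x" and t: "0 < t"
  shows "AE s in lebesgue. s \<in> {0..t} \<longrightarrow> A *v x s + B *v u s \<in> im E"
    and "s \<in> {0..t} \<Longrightarrow> w + integral {0..s} (\<lambda>r. A *v x r + B *v u r) \<in> im E"
proof -
  let ?g = "\<lambda>r. A *v x r + B *v u r"
  let ?p = "mat 1 - E ** X"
  have p: "v \<in> im E \<longleftrightarrow> ?p *v v = 0" for v
  proof
    assume "?p *v v = 0"
    then have "v = E *v (X *v v)"
      by (simp add: matrix_vector_mult_diff_rdistrib flip: matrix_vector_mul_assoc)
    then show "v \<in> im E" by (auto simp: im_def)
  qed (simp add: matrix_vector_mult_diff_rdistrib lift flip: matrix_vector_mul_assoc)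
  have g: "?g absolutely_integrable_on {0..t}"
    using tr by (auto intro!: absolutely_integrable_rhs simp: trajectory_def)
  have cZ: "continuous_on {0..t} (\<lambda>s. w + integral {0..s} ?g)"
    by (intro continuous_intros continuous_on_indefinite_integral g)
  have "?p *v (w + integral {0..s} ?g) = 0" if "s \<in> {0..t}" for s
  proof (rule continuous_AE_constant[OF _ _ t that])
    show "continuous_on {0..t} (\<lambda>s. ?p *v (w + integral {0..s} ?g))"
      by (rule continuous_on_compose2[OF matrix_vector_mult_linear_continuous_on[of UNIV] cZ]) auto
    have "AE s in lebesgue. s \<in> {0..t} \<longrightarrow> E *v x s = w + integral {0..s} ?g"
      using tr by (simp add: trajectory_def)
    then show "AE s in lebesgue. s \<in> {0..t} \<longrightarrow> ?p *v (w + integral {0..s} ?g) = 0"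
    proof eventually_elim
      case (elim s)
      show ?case
      proof
        assume "s \<in> {0..t}"
        then have "w + integral {0..s} ?g \<in> im E" using elim by (metis im_def rangeI)
        then show "?p *v (w + integral {0..s} ?g) = 0" using p by blast
      qed
    qed
  qed
  then show Z: "s \<in> {0..t} \<Longrightarrow> w + integral {0..s} ?g \<in> im E" for s
    using p by blast
  have w: "w \<in> im E" using tr by (simp add: trajectory_def)
  have "AE s in lebesgue. s \<in> {0..t} \<longrightarrow> ?p *v ?g s = 0"
  proof (rule AE_zero_if_indefinite_integral_zero[OF absolutely_integrable_matrix_vector[OF g]])
    fix s assume s: "s \<in> {0..t}"
    have "?g integrable_on {0..s}"
      using s by (auto intro!: set_lebesgue_integral_eq_integral(1) absolutely_integrable_on_subinterval[OF g])
    from integral_linear[OF this, of "(*v) ?p"]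
    have "integral {0..s} (\<lambda>r. ?p *v ?g r) = ?p *v integral {0..s} ?g"
      by (simp add: o_def)
    also have "\<dots> = ?p *v (w + integral {0..s} ?g) - ?p *v w"
      by (simp add: matrix_vector_right_distrib)
    also have "\<dots> = 0" using p Z[OF s] w by simp
    finally show "integral {0..s} (\<lambda>r. ?p *v ?g r) = 0" .
  qed
  then show "AE s in lebesgue. s \<in> {0..t} \<longrightarrow> ?g s \<in> im E"
    by eventually_elim (use p in blast)
qed

text \<open>A product of two integrable functions need not be integrable; here the control takes
  values in the bounded set \<open>U\<close>.\<close>

lemma supply_integrable:
  assumes tr: "trajectory E A B U t w w' u x"
  shows "(\<lambda>s. u s \<bullet> sys_output Q B (x s)) absolutely_integrable_on {0..t}"
proof -
  let ?y = "\<lambda>s. sys_output Q B (x s)"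
  obtain M where M: "\<And>u. u \<in> U \<Longrightarrow> norm u \<le> M"
    using U_bounded by (auto simp: bounded_iff)
  have u: "u absolutely_integrable_on {0..t}" and y: "?y absolutely_integrable_on {0..t}"
    using tr by (auto simp: trajectory_def sys_output_def intro: absolutely_integrable_matrix_vector)
  have "integrable lebesgue (\<lambda>s. indicat_real {0..t} s *\<^sub>R (u s \<bullet> ?y s))"
  proof (rule Bochner_Integration.integrable_bound)
    show "integrable lebesgue (\<lambda>s. M *\<^sub>R norm (indicat_real {0..t} s *\<^sub>R ?y s))"
      using y unfolding set_integrable_def by (intro integrable_scaleR_right integrable_norm)
    have "(\<lambda>s. (indicat_real {0..t} s *\<^sub>R u s) \<bullet> (indicat_real {0..t} s *\<^sub>R ?y s)) \<in> borel_measurable lebesgue"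
      using u y unfolding set_integrable_def
      by (intro borel_measurable_inner borel_measurable_integrable)
    also have "(\<lambda>s. (indicat_real {0..t} s *\<^sub>R u s) \<bullet> (indicat_real {0..t} s *\<^sub>R ?y s)) =
        (\<lambda>s. indicat_real {0..t} s *\<^sub>R (u s \<bullet> ?y s))"
      by (auto simp: indicator_def)
    finally show "\<dots> \<in> borel_measurable lebesgue" .
    have "AE s in lebesgue. s \<in> {0..t} \<longrightarrow> u s \<in> U" using tr by (simp add: trajectory_def)
    then show "AE s in lebesgue. norm (indicat_real {0..t} s *\<^sub>R (u s \<bullet> ?y s))
        \<le> norm (M *\<^sub>R norm (indicat_real {0..t} s *\<^sub>R ?y s))"
    proof eventually_elim
      case (elim s)
      show ?case
      proof (cases "s \<in> {0..t}")
        case True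
        then have "norm (u s) \<le> M" using elim M by blast
        then have "norm (u s) * norm (?y s) \<le> \<bar>M\<bar> * norm (?y s)"
          by (intro mult_right_mono) auto
        then show ?thesis
          using True Cauchy_Schwarz_ineq2[of "u s" "?y s"] by (simp add: abs_mult)
      qed simp
    qed
  qed
  then show ?thesis by (simp add: set_integrable_def)
qed

text \<open>Since \<open>x\<close> cannot be differentiated, the chain rule for \<open>H\<close> is
  replaced by integration by parts along the continuous curve of \<open>E x\<close>. The dissipation
  rate equals, almost everywhere, supplied power minus stored power, and inherits integrability from
  them.\<close>

lemma energy_balance:
  assumes tr: "trajectory E A B U t w w' u x"
  shows "(\<lambda>s. q (x s)) absolutely_integrable_on {0..t}"
    "integral {0..t} (\<lambda>s. u s \<bullet> sys_output Q B (x s)) = H w' - H w + integral {0..t} (\<lambda>s. q (x s))"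
proof -
  let ?y = "\<lambda>s. sys_output Q B (x s)"
  let ?g = "\<lambda>r. A *v x r + B *v u r"
  let ?z = "\<lambda>s. w + integral {0..s} ?g"
  have "(\<lambda>s. q (x s)) absolutely_integrable_on {0..t} \<and>
    integral {0..t} (\<lambda>s. u s \<bullet> ?y s) = H w' - H w + integral {0..t} (\<lambda>s. q (x s))"
  proof (cases "t = 0")
    case True
    then show ?thesis using tr by (simp add: trajectory_def)
  next
    case False
    then have t: "0 < t" using tr by (auto simp: trajectory_def)
    have g: "?g absolutely_integrable_on {0..t}"
      using tr by (auto intro!: absolutely_integrable_rhs simp: trajectory_def)
    note gE = trajectory_rhs_in_im(1)[OF tr t]
    note zE = trajectory_rhs_in_im(2)[OF tr t]
    let ?M = "Q ** X"
    have Mg: "(\<lambda>s. ?M *v ?g s) absolutely_integrable_on {0..t}"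
      by (rule absolutely_integrable_matrix_vector[OF g])
    have Mz: "?M *v ?z s = ?M *v w + integral {0..s} (\<lambda>s. ?M *v ?g s)" if "s \<in> {0..t}" for s
    proof -
      have "?g integrable_on {0..s}"
        using that by (auto intro!: set_lebesgue_integral_eq_integral(1) absolutely_integrable_on_subinterval[OF g])
      from integral_linear[OF this, of "(*v) ?M"] show ?thesis
        by (simp add: o_def matrix_vector_right_distrib)
    qed
    note parts = integral_by_parts_indefinite[OF Mg g Mz refl less_imp_le[OF t]]
    \<comment> \<open>Symmetry of \<open>Q ** X\<close> on \<open>im E\<close> makes both terms of
      the integration by parts equal, which accounts for the factor one half in
      \<open>H\<close>.\<close>
    have "integral {0..t} (\<lambda>s. (?M *v ?g s) \<bullet> ?z s) = integral {0..t} (\<lambda>s. (?M *v ?z s) \<bullet> ?g s)"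
    proof (rule integral_AE_cong(1))
      show "AE s in lebesgue. s \<in> {0..t} \<longrightarrow> (?M *v ?g s) \<bullet> ?z s = (?M *v ?z s) \<bullet> ?g s"
        using gE by eventually_elim (use zE inner_QX_commute in blast)
    qed
    then have power: "integral {0..t} (\<lambda>s. (?M *v ?z s) \<bullet> ?g s) = H w' - H w"
      using parts(3)[of w] tr by (simp add: H_def trajectory_def field_simps)
    have "AE s in lebesgue. s \<in> {0..t} \<longrightarrow> E *v x s = ?z s"
      using tr by (simp add: trajectory_def)
    with gE have q_ae: "AE s in lebesgue. s \<in> {0..t} \<longrightarrow> u s \<bullet> ?y s - (?M *v ?z s) \<bullet> ?g s = q (x s)"
    proof eventually_elim
      case (elim s)
      then show ?case using supply_rate[of "x s" "u s"] power_eq[of "?g s" "x s"] by auto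
    qed
    note uy = supply_integrable[OF tr]
    have "(\<lambda>s. u s \<bullet> ?y s - (?M *v ?z s) \<bullet> ?g s) absolutely_integrable_on {0..t}"
      by (intro set_integral_diff(1) uy parts(1))
    then have 1: "(\<lambda>s. q (x s)) absolutely_integrable_on {0..t}"
      using integral_AE_cong(2)[OF q_ae] by simp
    have "integral {0..t} (\<lambda>s. q (x s)) = integral {0..t} (\<lambda>s. u s \<bullet> ?y s - (?M *v ?z s) \<bullet> ?g s)"
      using integral_AE_cong(1)[OF q_ae] by simp
    also have "\<dots> = integral {0..t} (\<lambda>s. u s \<bullet> ?y s) - (H w' - H w)"
      unfolding power[symmetric]
      by (intro Henstock_Kurzweil_Integration.integral_diff set_lebesgue_integral_eq_integral(1) uy parts(1))
    finally show ?thesis using 1 by simp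
  qed
  then show "(\<lambda>s. q (x s)) absolutely_integrable_on {0..t}"
    "integral {0..t} (\<lambda>s. u s \<bullet> ?y s) = H w' - H w + integral {0..t} (\<lambda>s. q (x s))"
    by auto
qed

lemma cost_eq:
  assumes tr: "trajectory E A B U t w w' u x"
  shows "ocp_cost Q B t x u = H w' - H w + integral {0..t} (\<lambda>s. q (x s))"
  unfolding ocp_cost_def
  using set_lebesgue_integral_eq_integral(2)[OF supply_integrable[OF tr]] energy_balance(2)[OF tr] by simp

lemma trajectory_imp_steers:
  assumes tr: "trajectory E A B U t w w' u x"
  shows "\<exists>c. steers E A B U P t c w w'"
  using tr energy_balance(1)[OF tr] unfolding steers_def by blast

lemma infdist_le_dissipation:
  obtains c where "0 \<le> c" "\<And>x. (infdist x (ker (R ** Q)))\<^sup>2 \<le> c * q x"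
proof -
  obtain a where a: "0 \<le> a" "\<And>x. (infdist x (ker (R ** Q)))\<^sup>2 \<le> a * (norm ((R ** Q) *v x))\<^sup>2"
    by (rule infdist_ker_bound[of "R ** Q"]) (rule that; assumption)
  obtain b where b: "0 \<le> b" "\<And>y. (norm (R *v y))\<^sup>2 \<le> b * (y \<bullet> (R *v y))"
    by (rule symmetric_psd_norm_bound[OF R]) (rule that; assumption)
  show thesis
  proof
    show "(infdist x (ker (R ** Q)))\<^sup>2 \<le> (a * b) * q x" for x
    proof -
      have "(infdist x (ker (R ** Q)))\<^sup>2 \<le> a * (norm (R *v (Q *v x)))\<^sup>2"
        using a(2)[of x] by (simp flip: matrix_vector_mul_assoc)
      also have "\<dots> \<le> a * (b * q x)"
        unfolding q_eq by (intro mult_left_mono b a)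
      finally show ?thesis by simp
    qed
  qed (use a b in simp)
qed

end

theorem theorem4p4:
  fixes J R Q E :: "real^'n^'n" and B :: "real^'m^'n"
    and U :: "(real^'m) set" and \<Psi> :: "(real^'n) set"
    and wbar :: "real^'n" and ubar :: "real^'m"
  assumes "J = - transpose J"
    and "symmetric_psd R"
    and "transpose Q ** E = transpose E ** Q" and "symmetric_psd (transpose Q ** E)"
    and "R ** Q \<noteq> 0"
    and "regular_pencil E ((J - R) ** Q)"
    and "pencil_has_index E ((J - R) ** Q) 1"
    and "convex U" and "compact U" and "0 \<in> interior U"
    and "closed \<Psi>" and "\<Psi> \<subseteq> im E"
    and "wbar \<in> im E" and "ubar \<in> interior U"
    and "optimal_steady_state E J R Q B U wbar ubar"
    and "wbar \<in> reach_set_of E ((J - R) ** Q) B U \<Psi>"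
  shows "\<exists>F \<tau> :: real^'n \<Rightarrow> real.
     continuous_on (reach_set E ((J - R) ** Q) B U wbar) F \<and>
     continuous_on (reach_set E ((J - R) ** Q) B U wbar) \<tau> \<and>
     (\<forall>w0 \<in> reach_set E ((J - R) ** Q) B U wbar.
        0 \<le> F w0 \<and> 0 \<le> \<tau> w0 \<and>
        (\<forall>T > \<tau> w0. \<forall>x u. ocp_optimal_pair E J R Q B U \<Psi> T w0 x u \<longrightarrow>
           (\<integral>\<^sup>+ t\<in>{0..T}. ennreal ((infdist (x t) (ker (R ** Q)))\<^sup>2) \<partial>lebesgue) \<le> ennreal (F w0)))"
proof -
  let ?A = "(J - R) ** Q" and ?P = "transpose Q ** R ** Q"
  obtain X :: "real^'n^'n" where X: "\<And>w. w \<in> im E \<Longrightarrow> E *v (X *v w) = w"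
    "\<And>w. w \<in> im E \<Longrightarrow> ?A *v (X *v w) \<in> im E"
    using index_one_lift[OF assms(7)] by blast
  interpret ph: port_hamiltonian J R Q E X B U
    using assms X compact_imp_bounded by unfold_locales auto
  obtain xbar where xbar: "steady_state_with E J R Q B U wbar ubar xbar"
    "\<And>w' u' x'. steady_state_with E J R Q B U w' u' x' \<Longrightarrow>
       ubar \<bullet> sys_output Q B xbar \<le> u' \<bullet> sys_output Q B x'"
    using assms(15) by (auto simp: optimal_steady_state_def)
  have steady: "E *v xbar = wbar" "?A *v xbar + B *v ubar = 0"
    using xbar(1) by (auto simp: steady_state_with_def)
  have "0 \<in> U" using assms(10) interior_subset by blast
  then have "steady_state_with E J R Q B U 0 0 0"
    by (auto simp: steady_state_with_def im_def intro: range_eqI[of _ _ 0])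
  then have "ubar \<bullet> sys_output Q B xbar \<le> 0"
    using xbar(2) by fastforce
  then have q0: "ph.q xbar = 0"
  proof -
    have "0 \<le> ph.q xbar" using ph.P_psd unfolding symmetric_psd_def by blast
    moreover have "ubar \<bullet> sys_output Q B xbar - ph.q xbar = 0"
      using ph.supply_rate[of xbar ubar] unfolding steady(2) by simp
    ultimately show ?thesis using \<open>ubar \<bullet> sys_output Q B xbar \<le> 0\<close> by linarith
  qed
  \<comment> \<open>A vanishing form value is not enough for the reflection, whose cross terms
    involve \<open>P *v xbar\<close> itself; semidefiniteness bridges the gap.\<close>
  have Pxbar: "?P *v xbar = 0"
  proof -
    obtain c where "\<And>y. (norm (?P *v y))\<^sup>2 \<le> c * ph.q y"
      using symmetric_psd_norm_bound[OF ph.P_psd] by blast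
    from this[of xbar] q0 show ?thesis by simp
  qed
  interpret sd: steady_descriptor_system E ?A X ?P B U xbar ubar
    using X ph.P_psd Pxbar assms steady(2) by unfold_locales auto
  have wbar: "E *v xbar \<in> im E" by (simp add: im_def)

  \<comment> \<open>Reachability puts no limit on dissipation, but the energy balance makes it
    finite along every trajectory, so the budgets in \<open>sd.D\<close> exclude no point.\<close>
  have S: "reach_set E ?A B U wbar = sd.S"
  proof (intro equalityI subsetI)
    fix w assume "w \<in> reach_set E ?A B U wbar"
    then obtain t where t: "0 \<le> t" "w \<in> reach_set_at E ?A B U t (E *v xbar)"
      by (auto simp: reach_set_def steady)
    then obtain u x where "trajectory E ?A B U t w (E *v xbar) u x"
      using reach_set_at_iff_trajectory[OF t(1) wbar] by blast
    then show "w \<in> sd.S"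
      using ph.trajectory_imp_steers sd.steer_imp_S by blast
  next
    fix w assume "w \<in> sd.S"
    then obtain r u x where tr: "trajectory E ?A B U r w (E *v xbar) u x"
      by (auto simp: sd.S_def sd.D_def steers_def)
    then have r: "0 \<le> r" by (simp add: trajectory_def)
    then have "w \<in> reach_set_at E ?A B U r (E *v xbar)"
      using tr reach_set_at_iff_trajectory[OF r wbar] by blast
    then show "w \<in> reach_set E ?A B U wbar"
      using r steady(1) by (auto simp: reach_set_def)
  qed

  obtain \<psi> t2 where \<psi>: "\<psi> \<in> \<Psi>" "0 \<le> t2" "wbar \<in> reach_set_at E ?A B U t2 \<psi>"
    using assms(16) by (auto simp: reach_set_of_def reach_set_def)
  have \<psi>E: "\<psi> \<in> im E" using \<psi>(1) assms(12) by blast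
  obtain u2 x2 where "trajectory E ?A B U t2 (E *v xbar) \<psi> u2 x2"
    using \<psi> reach_set_at_iff_trajectory[OF \<psi>(2) \<psi>E] steady(1) by blast
  then obtain c2' where c2': "sd.steer t2 c2' (E *v xbar) \<psi>"
    using ph.trajectory_imp_steers by blast
  define c2 where "c2 = max 0 c2'"
  have c2: "sd.steer t2 c2 (E *v xbar) \<psi>" "0 \<le> c2"
    using c2' by (force simp: steers_def c2_def)+
  obtain g where g: "continuous_on sd.S g" "\<And>w. w \<in> sd.S \<Longrightarrow> 0 \<le> g w"
    "\<And>w. w \<in> sd.S \<Longrightarrow> sd.steer (g w) (g w) w (E *v xbar)"
    using sd.continuous_steering_bound by blast
  obtain c where c: "0 \<le> c" "\<And>x. (infdist x (ker (R ** Q)))\<^sup>2 \<le> c * ph.q x"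
    using ph.infdist_le_dissipation by blast

  \<comment> \<open>\<open>H w0\<close> cancels between the two costs and the final energy of the
    optimal pair is dropped as nonnegative. What remains is the energy at \<psi> and the dissipation
    of the two steering phases; \<open>c\<close> converts dissipation into squared distance.
    Accordingly \<tau> is the time of both phases, and the surplus \<open>T - \<tau> w0\<close> is
    spent waiting.\<close>
  define F where "F = (\<lambda>w. c * (ph.H \<psi> + g w + c2))"
  define \<tau> where "\<tau> = (\<lambda>w. g w + t2)"
  have main: "(\<integral>\<^sup>+ t\<in>{0..T}. ennreal ((infdist (x t) (ker (R ** Q)))\<^sup>2) \<partial>lebesgue) \<le> ennreal (F w0)"
    if w0: "w0 \<in> sd.S" and T: "T > \<tau> w0" and opt: "ocp_optimal_pair E J R Q B U \<Psi> T w0 x u" for w0 T x u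
  proof -
    have Tpos: "0 < T" using T g(2)[OF w0] \<psi>(2) by (simp add: \<tau>_def)
    have feasible_iff: "ocp_feasible E J R Q B U \<Psi> T w0 x u \<longleftrightarrow>
        (\<exists>w\<in>\<Psi>. trajectory E ?A B U T w0 w u x)" for x u
      using sd.S_subset[OF w0] by (auto simp: ocp_feasible_def trajectory_iff_solution[OF Tpos])
    obtain w where w: "w \<in> \<Psi>" "trajectory E ?A B U T w0 w u x"
      using opt feasible_iff by (auto simp: ocp_optimal_pair_def)
    have wE: "w \<in> im E" using w(1) assms(12) by blast
    have "sd.steer (T - \<tau> w0) 0 (E *v xbar) (E *v xbar)"
      using T by (intro sd.steer_stay) simp
    from steers_join[OF steers_join[OF g(3)[OF w0] this] c2(1)]
    have "sd.steer T (g w0 + c2) w0 \<psi>" by (simp add: \<tau>_def)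
    then obtain u' x' where tr': "trajectory E ?A B U T w0 \<psi> u' x'"
      "integral {0..T} (\<lambda>s. ph.q (x' s)) \<le> g w0 + c2"
      by (auto simp: steers_def)
    have "ocp_feasible E J R Q B U \<Psi> T w0 x' u'"
      using feasible_iff \<psi>(1) tr'(1) by blast
    then have "ocp_cost Q B T x u \<le> ocp_cost Q B T x' u'"
      using opt unfolding ocp_optimal_pair_def by blast
    then have le: "integral {0..T} (\<lambda>s. ph.q (x s)) \<le> ph.H \<psi> + g w0 + c2"
      using ph.cost_eq[OF w(2)] ph.cost_eq[OF tr'(1)] tr'(2) ph.H_nonneg[OF wE] by simp
    have qi: "(\<lambda>s. ph.q (x s)) absolutely_integrable_on {0..T}"
      by (rule ph.energy_balance(1)[OF w(2)])
    have q_nonneg: "0 \<le> ph.q z" for z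
      using ph.P_psd by (simp add: symmetric_psd_def)
    \<comment> \<open>The nonnegative integral makes finiteness part of the claim; pointwise
      domination by the integrable dissipation rate suffices.\<close>
    have "(\<integral>\<^sup>+ t\<in>{0..T}. ennreal ((infdist (x t) (ker (R ** Q)))\<^sup>2) \<partial>lebesgue) \<le>
        (\<integral>\<^sup>+ t. ennreal (indicat_real {0..T} t *\<^sub>R (c * ph.q (x t))) \<partial>lebesgue)"
      by (intro nn_integral_mono) (use c(2) in \<open>auto simp: indicator_def intro: ennreal_leI\<close>)
    also have "\<dots> = ennreal (LINT t|lebesgue. indicat_real {0..T} t *\<^sub>R (c * ph.q (x t)))"
    proof (rule nn_integral_eq_integral)
      show "integrable lebesgue (\<lambda>t. indicat_real {0..T} t *\<^sub>R (c * ph.q (x t)))"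
        using set_integrable_mult_right[of c lebesgue "{0..T}"] qi by (simp add: set_integrable_def)
    qed (use c(1) q_nonneg in \<open>auto simp: indicator_def\<close>)
    also have "(LINT t|lebesgue. indicat_real {0..T} t *\<^sub>R (c * ph.q (x t))) =
        c * integral {0..T} (\<lambda>s. ph.q (x s))"
      using set_lebesgue_integral_eq_integral(2)[OF qi]
      by (simp add: set_lebesgue_integral_def mult.left_commute)
    also have "ennreal \<dots> \<le> ennreal (F w0)"
      unfolding F_def by (intro ennreal_leI mult_left_mono le c(1))
    finally show ?thesis .
  qed
  show ?thesis
    unfolding S
  proof (rule exI[of _ F], rule exI[of _ \<tau>], intro conjI ballI allI impI)
    show "continuous_on sd.S F" "continuous_on sd.S \<tau>"
      unfolding F_def \<tau>_def by (intro continuous_intros g(1))+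
    fix w0 assume w0: "w0 \<in> sd.S"
    show "0 \<le> F w0" "0 \<le> \<tau> w0"
      using c(1) c2(2) g(2)[OF w0] ph.H_nonneg[OF \<psi>E] \<psi>(2) by (auto simp: F_def \<tau>_def)
  qed (use main in blast)
qed

end
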